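(* Let $g$ be a non-negative real-valued multiplicative function such that: (a) $g$ is uniformly bounded on the primes, i.e. $g(p)\le \beta$ for some constant $\beta$ and all primes $p$; (b) the series $\sum q^{-1} g(q)$, taken over the prime-powers $q=p^k$ with $k\ge 2$, converges; (c) the sums $y^{-1}\sum_{q\le y} g(q)\log q$, where $q$ runs over all prime-powers, are uniformly bounded for $y\ge 2$. Let $h$ be a complex-valued multiplicative function satisfying $|h(n)|\le g(n)$ for all $n\ge1$. Set $G(x)=\sum_{n\le x} n^{-1}g(n)$ and $H(x)=\sum_{n\le x} n^{-1}h(n)$ for $x\ge 1$. Then, as $x\to\infty$, \[ H(x) = \left( \prod_{p\le x} \left(1+\frac{h(p)}{p}+\frac{h(p^2)}{p^2}+\cdots\right)\left(1+\frac{g(p)}{p}+\frac{g(p^2)}{p^2}+\cdots\right)^{-1} + o(1)\right) G(x). \]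
   Context: Multiplicative means $f(mn)=f(m)f(n)$ whenever $\gcd(m,n)=1$, with $f(1)=1$. The product is over primes $p\le x$. *)

theory Defs
  imports "HOL-Analysis.Analysis" "HOL-Number_Theory.Prime_Powers"
begin

definition multiplicative :: "(nat \<Rightarrow> 'a :: comm_semiring_1) \<Rightarrow> bool" where
  "multiplicative f \<longleftrightarrow> f 1 = 1 \<and> (\<forall>m n. coprime m n \<longrightarrow> f (m * n) = f m * f n)"

end

theory Submission
  imports Defs
begin

text \<open>
  Write \<open>F\<^sub>f(\<sigma>) = \<Sum> f(n) n\<^bsup>-1-\<sigma>\<^esup>\<close>, \<open>L = log x\<close>, and let \<open>P(x)\<close> be the product in the theorem.
  The Euler products give \<open>F\<^sub>h(c/L) = (P(x) + o(1)) F\<^sub>g(c/L)\<close> for each fixed \<open>c > 0\<close>. If \<open>P(x) \<rightarrow> 0\<close>,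
  this follows from finitely many factors, as every factor of \<open>F\<^sub>h/F\<^sub>g\<close> has modulus at most 1.
  Otherwise \<open>\<Sum> (g(p) - Re h(p))/p\<close> converges, and together with
  \<open>|g(p) - h(p)|\<^sup>2 \<le> 2 g(p) (g(p) - Re h(p))\<close> and condition (c) this shows that the truncation at
  \<open>p \<le> x\<close> and the factors \<open>p\<^bsup>-\<sigma>\<^esup>\<close> change the product by \<open>o(1)\<close> only.

  The inequality \<open>g(n) log n \<le> \<Sum> g(m) g(q) log q\<close>, summed over \<open>n = mq\<close> with \<open>q\<close> a prime power,
  turns condition (c) into two facts about \<open>G\<close>. Weighted by \<open>n\<^bsup>-1-\<sigma>\<^esup>\<close>, it shows that the \<open>n\<close> with
  \<open>log n\<close> larger than a multiple of \<open>C/\<sigma>\<close> contribute at most half of \<open>F\<^sub>g(\<sigma>)\<close>, so that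
  \<open>F\<^sub>g(A/L) \<le> 2 G(x)\<close> for a suitable constant \<open>A\<close>; weighted by \<open>1/n\<close>, it bounds the sum of \<open>g(n)/n\<close>
  over \<open>x < n \<le> x\<^bsup>1+\<epsilon>\<^esup>\<close> by \<open>O((\<epsilon> + 1/L) F\<^sub>g(A/L))\<close>.

  Karamata's method transfers the comparison of \<open>F\<^sub>h\<close> and \<open>F\<^sub>g\<close> to the partial sums: approximating
  the function that is \<open>1/u\<close> for \<open>u \<ge> e\<^bsup>-A\<^esup>\<close> and 0 elsewhere by a polynomial in \<open>u = n\<^bsup>-A/L\<^esup>\<close>
  expresses \<open>H(x)\<close> and \<open>G(x)\<close> through the values \<open>F(kA/L)\<close>, up to a short sum around the jump.
\<close>

subsection \<open>Euler products\<close>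

lemma finite_nats_le [simp]: "finite {n::nat. P n \<and> real n \<le> x}"
  by (rule finite_subset[of _ "{..nat \<lfloor>x\<rfloor>}"]) (auto simp: le_nat_iff le_floor_iff)

definition primes_upto :: "real \<Rightarrow> nat set" where
  "primes_upto x = {p. prime p \<and> real p \<le> x}"

lemma finite_primes_upto [simp]: "finite (primes_upto x)"
  by (simp add: primes_upto_def)

lemma prime_if_mem_primes_upto [dest]: "p \<in> primes_upto x \<Longrightarrow> prime p"
  by (simp add: primes_upto_def)

lemma primes_upto_mono: "x \<le> y \<Longrightarrow> primes_upto x \<subseteq> primes_upto y"
  by (auto simp: primes_upto_def)

definition smooth_nats :: "nat set \<Rightarrow> nat set" where
  "smooth_nats A = {n. n > 0 \<and> prime_factors n \<subseteq> A}"

lemma smooth_nats_empty: "smooth_nats {} = {1}"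
  by (auto simp: smooth_nats_def prime_factorization_empty_iff set_mset_eq_empty_iff)

lemma mem_smooth_nats_primes_upto:
  assumes "n > 0" "real n \<le> x"
  shows "n \<in> smooth_nats (primes_upto x)"
proof -
  have "real p \<le> x" if "p dvd n" for p
    using dvd_imp_le[OF that] assms by linarith
  thus ?thesis using assms by (auto simp: smooth_nats_def primes_upto_def)
qed

lemma not_dvd_smooth_nat: "prime p \<Longrightarrow> p \<notin> A \<Longrightarrow> m \<in> smooth_nats A \<Longrightarrow> \<not> p dvd m"
  by (auto simp: smooth_nats_def in_prime_factors_iff subset_iff)

lemma coprime_prime_power_smooth_nat:
  "prime p \<Longrightarrow> p \<notin> A \<Longrightarrow> m \<in> smooth_nats A \<Longrightarrow> coprime (p ^ k) m"
  using not_dvd_smooth_nat by (simp add: prime_imp_coprime coprime_power_left_iff)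

lemma bij_betw_smooth_nats_insert:
  assumes new_prime: "prime p" "p \<notin> A"
  shows "bij_betw (\<lambda>(k, m). p ^ k * m) (UNIV \<times> smooth_nats A) (smooth_nats (insert p A))"
proof (rule bij_betwI)
  define split where "split n = (multiplicity p n, n div p ^ multiplicity p n)" for n
  have "p ^ k * m \<in> smooth_nats (insert p A)" if "m \<in> smooth_nats A" for k m
  proof -
    have "prime_factors (p ^ k) \<subseteq> {p}"
      using new_prime by (cases "k = 0") (auto simp: prime_factorization_prime_power)
    thus ?thesis
      using that new_prime by (auto simp: smooth_nats_def prime_factors_product prime_gt_0_nat)
  qed
  thus "(\<lambda>(k, m). p ^ k * m) \<in> UNIV \<times> smooth_nats A \<rightarrow> smooth_nats (insert p A)"
    by auto
  have "n div p ^ multiplicity p n \<in> smooth_nats A" if "n \<in> smooth_nats (insert p A)" for n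
  proof -
    let ?m = "n div p ^ multiplicity p n"
    have "n \<noteq> 0" using that by (simp add: smooth_nats_def)
    hence "\<not> p dvd ?m" using new_prime by (intro multiplicity_decompose) auto
    moreover from this have "?m \<noteq> 0" by (metis dvd_0_right)
    moreover have "prime_factors ?m \<subseteq> prime_factors n"
      using \<open>n \<noteq> 0\<close> by (intro dvd_prime_factors div_dvd_iff_mult[THEN iffD2])
        (use new_prime in \<open>auto simp: multiplicity_dvd\<close>)
    ultimately show ?thesis using that by (auto simp: smooth_nats_def)
  qed
  thus "split \<in> smooth_nats (insert p A) \<rightarrow> UNIV \<times> smooth_nats A"
    by (simp add: split_def)
  have "multiplicity p (p ^ k * m) = k" if "m \<in> smooth_nats A" for k m
    using not_dvd_smooth_nat[OF new_prime that] new_prime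
    by (intro multiplicity_eqI) (auto simp: prime_gt_0_nat power_Suc2 simp del: power_Suc)
  thus "split ((\<lambda>(k, m). p ^ k * m) km) = km" if "km \<in> UNIV \<times> smooth_nats A" for km
    using that new_prime by (auto simp: split_def)
  show "(\<lambda>(k, m). p ^ k * m) (split n) = n" for n
    by (simp add: split_def multiplicity_dvd)
qed

lemma multiplicative_coprime: "multiplicative f \<Longrightarrow> coprime m n \<Longrightarrow> f (m * n) = f m * f n"
  by (simp add: multiplicative_def)

lemma multiplicative_1: "multiplicative f \<Longrightarrow> f (Suc 0) = 1"
  by (simp add: multiplicative_def)

lemma
  fixes f :: "'a \<Rightarrow> 'c :: {real_normed_field, banach}" and g :: "'b \<Rightarrow> 'c"
  assumes f_sum: "(f has_sum s) A" "(\<lambda>x. norm (f x)) summable_on A"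
    and g_sum: "(g has_sum t) B" "(\<lambda>y. norm (g y)) summable_on B"
  shows abs_summable_on_Times_mult: "(\<lambda>(x, y). norm (f x * g y)) summable_on (A \<times> B)"
    and has_sum_Times_mult: "((\<lambda>(x, y). f x * g y) has_sum (s * t)) (A \<times> B)"
proof -
  have abs_summable: "(\<lambda>z. norm (case z of (x, y) \<Rightarrow> f x * g y)) summable_on (A \<times> B)"
    unfolding Infinite_Sum.abs_summable_on_Sigma_iff
    using f_sum(2) g_sum(2)
    by (auto simp: norm_mult infsum_cmult_right abs_mult infsum_nonneg
        intro: summable_on_cmult_right summable_on_cmult_left)
  thus "(\<lambda>(x, y). norm (f x * g y)) summable_on (A \<times> B)"
    by (simp add: case_prod_unfold)
  show "((\<lambda>(x, y). f x * g y) has_sum (s * t)) (A \<times> B)"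
  proof (rule has_sum_SigmaI)
    show "((\<lambda>y. case (x, y) of (x, y) \<Rightarrow> f x * g y) has_sum (f x * t)) B" for x
      using g_sum(1) by (auto intro: has_sum_cmult_right)
    show "((\<lambda>x. f x * t) has_sum (s * t)) A"
      using f_sum(1) by (rule has_sum_cmult_left)
    show "(\<lambda>(x, y). f x * g y) summable_on A \<times> B"
      using abs_summable abs_summable_summable by blast
  qed
qed

lemma has_sum_smooth_nats:
  fixes f :: "nat \<Rightarrow> 'a :: {real_normed_field, banach}"
  assumes mult: "multiplicative f" and "finite A" "\<And>p. p \<in> A \<Longrightarrow> prime p"
    and "\<And>p. p \<in> A \<Longrightarrow> summable (\<lambda>k. norm (f (p ^ k)))"
  shows "(f has_sum (\<Prod>p\<in>A. \<Sum>k. f (p ^ k))) (smooth_nats A) \<and>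
    (\<lambda>n. norm (f n)) summable_on smooth_nats A"
  using assms(2,3,4)
proof (induction A rule: finite_induct)
  case empty
  have "(f has_sum f 1) {1}" using has_sum_finite[of "{1}" f] by simp
  thus ?case using mult by (simp add: smooth_nats_empty multiplicative_1)
next
  case (insert p A)
  have new_prime: "prime p" "p \<notin> A" using insert by auto
  let ?F = "\<lambda>k. f (p ^ k)"
  have "summable (\<lambda>k. norm (?F k))" using insert.prems by auto
  hence prime_powers: "(?F has_sum (\<Sum>k. ?F k)) UNIV" "(\<lambda>k. norm (?F k)) summable_on UNIV"
    by (auto intro!: norm_summable_imp_has_sum summable_sums summable_norm_cancel
        simp: summable_on_UNIV_nonneg_real_iff)
  have smooth: "(f has_sum (\<Prod>p\<in>A. \<Sum>k. f (p ^ k))) (smooth_nats A)"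
    "(\<lambda>n. norm (f n)) summable_on smooth_nats A"
    using insert.IH insert.prems by auto
  note bij = bij_betw_smooth_nats_insert[OF new_prime]
  have f_mult: "f (p ^ k * m) = ?F k * f m" if "m \<in> smooth_nats A" for k m
    by (rule multiplicative_coprime[OF mult coprime_prime_power_smooth_nat[OF new_prime that]])
  have "(f has_sum ((\<Sum>k. ?F k) * (\<Prod>p\<in>A. \<Sum>k. f (p ^ k)))) (smooth_nats (insert p A))"
    unfolding has_sum_reindex_bij_betw[OF bij, symmetric]
    using has_sum_Times_mult[OF prime_powers smooth]
    by (rule has_sum_cong[THEN iffD1, rotated]) (auto simp: f_mult)
  moreover have "(\<lambda>n. norm (f n)) summable_on smooth_nats (insert p A)"
    unfolding summable_on_reindex_bij_betw[OF bij, symmetric]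
    using abs_summable_on_Times_mult[OF prime_powers smooth]
    by (rule summable_on_cong[THEN iffD1, rotated]) (auto simp: f_mult)
  ultimately show ?case using insert by simp
qed

lemma summable_norm_prime_powers:
  fixes f :: "nat \<Rightarrow> 'a :: real_normed_vector"
  assumes "summable (\<lambda>n. norm (f n))" "prime p"
  shows "summable (\<lambda>k. norm (f (p ^ k)))"
proof -
  have "inj (\<lambda>k. p ^ k)" using prime_gt_1_nat[OF assms(2)] by (auto simp: inj_def)
  from summable_reindex[OF assms(1) this] show ?thesis by (simp add: o_def)
qed

lemma euler_product_tendsto:
  fixes f :: "nat \<Rightarrow> 'a :: {real_normed_field, banach}"
  assumes mult: "multiplicative f" and f_0: "f 0 = 0" and abs_summable: "summable (\<lambda>n. norm (f n))"
  shows "((\<lambda>x. \<Prod>p\<in>primes_upto x. \<Sum>k. f (p ^ k)) \<longlongrightarrow> (\<Sum>n. f n)) at_top"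
proof -
  define smooth_part where
    "smooth_part n x = (if n \<in> smooth_nats (primes_upto x) then f n else 0)" for n x
  have "(\<Prod>p\<in>primes_upto x. \<Sum>k. f (p ^ k)) = (\<Sum>n. smooth_part n x)" for x
  proof -
    have "(f has_sum (\<Prod>p\<in>primes_upto x. \<Sum>k. f (p ^ k))) (smooth_nats (primes_upto x))"
      using has_sum_smooth_nats[OF mult finite_primes_upto]
        summable_norm_prime_powers[OF abs_summable]
      by auto
    hence "((\<lambda>n. smooth_part n x) has_sum (\<Prod>p\<in>primes_upto x. \<Sum>k. f (p ^ k))) UNIV"
      by (rule has_sum_cong_neutral[THEN iffD1, rotated -1]) (auto simp: smooth_part_def)
    thus ?thesis by (intro sums_unique has_sum_imp_sums)
  qed
  moreover have "((\<lambda>x. \<Sum>n. smooth_part n x) \<longlongrightarrow> (\<Sum>n. f n)) at_top"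
  proof (intro tannerys_theorem[where M = "\<lambda>n. norm (f n)", THEN conjunct2, THEN conjunct2]
      abs_summable)
    fix n
    have "\<forall>\<^sub>F x in at_top. smooth_part n x = f n"
      using eventually_ge_at_top[of "real n"]
      by eventually_elim
        (use f_0 in \<open>cases "n = 0", auto simp: smooth_part_def mem_smooth_nats_primes_upto\<close>)
    thus "((\<lambda>x. smooth_part n x) \<longlongrightarrow> f n) at_top" by (rule tendsto_eventually)
  qed (auto simp: smooth_part_def case_prod_unfold)
  ultimately show ?thesis by simp
qed

subsection \<open>Dirichlet series and prime powers\<close>

definition dirichlet_term :: "(nat \<Rightarrow> 'a :: real_normed_field) \<Rightarrow> real \<Rightarrow> nat \<Rightarrow> 'a" where
  "dirichlet_term f \<sigma> n = f n / of_nat n * of_real (real n powr (- \<sigma>))"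

definition dirichlet_series :: "(nat \<Rightarrow> 'a :: real_normed_field) \<Rightarrow> real \<Rightarrow> 'a" where
  "dirichlet_series f \<sigma> = (\<Sum>n. dirichlet_term f \<sigma> n)"

definition euler_factor :: "(nat \<Rightarrow> 'a :: real_normed_field) \<Rightarrow> real \<Rightarrow> nat \<Rightarrow> 'a" where
  "euler_factor f \<sigma> p = (\<Sum>k. dirichlet_term f \<sigma> (p ^ k))"

definition log_sum :: "(nat \<Rightarrow> 'a :: real_normed_field) \<Rightarrow> real \<Rightarrow> 'a" where
  "log_sum f x = (\<Sum>n | 1 \<le> n \<and> real n \<le> x. f n / of_nat n)"

definition primepow_log :: "(nat \<Rightarrow> real) \<Rightarrow> nat \<Rightarrow> real" where
  "primepow_log f q = (if primepow q then f q * ln (real q) else 0)"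

lemma powr_uminus_le_1: "x \<ge> 1 \<Longrightarrow> \<sigma> \<ge> 0 \<Longrightarrow> x powr (- \<sigma>) \<le> (1::real)"
  using powr_mono[of "- \<sigma>" 0 x] by simp

lemma dirichlet_term_0 [simp]: "dirichlet_term f \<sigma> 0 = 0"
  by (simp add: dirichlet_term_def)

lemma dirichlet_term_1: "multiplicative f \<Longrightarrow> dirichlet_term f \<sigma> (Suc 0) = 1"
  by (simp add: dirichlet_term_def multiplicative_1)

lemma dirichlet_term_zero_exponent: "dirichlet_term f 0 n = f n / of_nat n"
  by (cases "n = 0") (auto simp: dirichlet_term_def)

lemma dirichlet_term_nonneg:
  fixes f :: "nat \<Rightarrow> real"
  shows "f n \<ge> 0 \<Longrightarrow> dirichlet_term f \<sigma> n \<ge> 0"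
  by (simp add: dirichlet_term_def)

lemma norm_dirichlet_term_le:
  assumes "n \<ge> 1 \<Longrightarrow> norm (f n) \<le> g n" "\<tau> \<le> \<sigma>"
  shows "norm (dirichlet_term f \<sigma> n) \<le> dirichlet_term g \<tau> n"
proof (cases "n = 0")
  case False
  have "norm (f n) / real n * real n powr (- \<sigma>) \<le> g n / real n * real n powr (- \<tau>)"
    using assms False order.trans[OF norm_ge_zero]
    by (intro mult_mono divide_right_mono powr_mono divide_nonneg_nonneg) auto
  thus ?thesis by (simp add: dirichlet_term_def norm_mult norm_divide)
qed auto

lemma multiplicative_dirichlet_term: "multiplicative f \<Longrightarrow> multiplicative (dirichlet_term f \<sigma>)"
  by (auto simp: multiplicative_def dirichlet_term_def powr_mult)

lemma dirichlet_term_primepow_log: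
  "dirichlet_term (primepow_log f) \<sigma> = primepow_log (dirichlet_term f \<sigma>)"
  by (auto simp: fun_eq_iff primepow_log_def dirichlet_term_def)

lemma primepow_log_nonneg: "(\<And>n. f n \<ge> 0) \<Longrightarrow> primepow_log f q \<ge> 0"
  by (auto simp: primepow_log_def dest: primepow_gt_0_nat)

lemma gt_1_if_primepow_log_neq_0: "primepow_log f q \<noteq> 0 \<Longrightarrow> q > 1"
  by (auto simp: primepow_log_def dest: primepow_gt_Suc_0 split: if_splits)

lemma ln_eq_sum_prime_factors:
  assumes "n > 0"
  shows "ln (real n) = (\<Sum>p\<in>prime_factors n. ln (real (p ^ multiplicity p n)))"
proof -
  have "real n = (\<Prod>p\<in>prime_factors n. real (p ^ multiplicity p n))"
    using prime_factorization_nat[OF assms] by (metis of_nat_prod)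
  also have "ln \<dots> = (\<Sum>p\<in>prime_factors n. ln (real (p ^ multiplicity p n)))"
    by (rule ln_prod) (auto simp: in_prime_factors_iff prime_gt_0_nat)
  finally show ?thesis .
qed

lemma mult_ln_le_sum_divisors:
  assumes mult: "multiplicative f" and nonneg: "\<And>n. f n \<ge> 0" and "n > 0"
  shows "f n * ln (real n) \<le> (\<Sum>d | d dvd n. f (n div d) * primepow_log f d)"
proof -
  define part where "part p = p ^ multiplicity p n" for p
  have prime_p: "prime p" "multiplicity p n > 0" if "p \<in> prime_factors n" for p
    using that \<open>n > 0\<close> by (auto simp: in_prime_factors_iff prime_multiplicity_gt_zero_iff)
  have part: "primepow (part p)" "f n = f (n div part p) * f (part p)"
    if "p \<in> prime_factors n" for p
  proof -
    show "primepow (part p)" using prime_p[OF that] by (simp add: part_def)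
    have "\<not> p dvd n div part p"
      unfolding part_def using prime_p[OF that] \<open>n > 0\<close> by (intro multiplicity_decompose) auto
    hence "coprime (n div part p) (part p)"
      using prime_p[OF that]
      by (simp add: part_def coprime_commute prime_imp_coprime coprime_power_right_iff)
    from multiplicative_coprime[OF mult this] show "f n = f (n div part p) * f (part p)"
      by (simp add: part_def multiplicity_dvd)
  qed
  have "inj_on part (prime_factors n)"
    using prime_p by (force simp: inj_on_def part_def prime_power_inj'')
  have "f n * ln (real n) = (\<Sum>p\<in>prime_factors n. f n * ln (real (part p)))"
    by (simp add: ln_eq_sum_prime_factors[OF \<open>n > 0\<close>] part_def sum_distrib_left)
  also have "\<dots> = (\<Sum>p\<in>prime_factors n. f (n div part p) * primepow_log f (part p))"
    using part by (intro sum.cong) (auto simp: primepow_log_def)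
  also have "\<dots> = (\<Sum>d\<in>part ` prime_factors n. f (n div d) * primepow_log f d)"
    by (simp add: sum.reindex[OF \<open>inj_on part (prime_factors n)\<close>])
  also have "\<dots> \<le> (\<Sum>d | d dvd n. f (n div d) * primepow_log f d)"
    using \<open>n > 0\<close>
    by (intro sum_mono2 mult_nonneg_nonneg nonneg primepow_log_nonneg)
      (auto simp: part_def multiplicity_dvd)
  finally show ?thesis .
qed

lemma finite_mult_vimage: "finite I \<Longrightarrow> m > 0 \<Longrightarrow> finite {q::nat. m * q \<in> I}"
  using finite_vimageI[of I "(*) m"] by (simp add: inj_def vimage_def)

lemma sum_mult_ln_le:
  assumes mult: "multiplicative f" and nonneg: "\<And>n. f n \<ge> 0" and I_subset: "I \<subseteq> {1..N}"
    and inner: "\<And>m. m \<in> {1..N} \<Longrightarrow> (\<Sum>q | m * q \<in> I. primepow_log f q) \<le> B"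
  shows "(\<Sum>n\<in>I. f n * ln (real n)) \<le> (\<Sum>m=1..N. f m) * B"
proof -
  have fin_I: "finite I" using I_subset finite_subset by blast
  have "(\<Sum>n\<in>I. f n * ln (real n)) \<le> (\<Sum>n\<in>I. \<Sum>d | d dvd n. f (n div d) * primepow_log f d)"
    using I_subset by (intro sum_mono mult_ln_le_sum_divisors mult nonneg) (auto simp: subset_iff)
  also have "\<dots> = (\<Sum>(n, d)\<in>Sigma I (\<lambda>n. {d. d dvd n}). f (n div d) * primepow_log f d)"
    using I_subset fin_I by (intro sum.Sigma) force+
  also have "\<dots> = (\<Sum>(m, q)\<in>Sigma {1..N} (\<lambda>m. {q. m * q \<in> I}). f m * primepow_log f q)"
  proof (rule sum.reindex_bij_witness
      [where i = "\<lambda>(m, q). (m * q, q)" and j = "\<lambda>(n, d). (n div d, d)"])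
    fix nd assume "nd \<in> Sigma I (\<lambda>n. {d. d dvd n})"
    then obtain n d where "nd = (n, d)" "n \<in> I" "d dvd n" by auto
    moreover from this have "1 \<le> n" "n \<le> N" using I_subset by auto
    ultimately show "(\<lambda>(n, d). (n div d, d)) nd \<in> Sigma {1..N} (\<lambda>m. {q. m * q \<in> I})"
      by (auto simp: Suc_le_eq div_greater_zero_iff dvd_imp_le
          intro: order.trans[OF div_le_dividend])
  next
    fix mq assume "mq \<in> Sigma {1..N} (\<lambda>m. {q. m * q \<in> I})"
    thus "(\<lambda>(n, d). (n div d, d)) ((\<lambda>(m, q). (m * q, q)) mq) = mq"
      using I_subset by (cases "snd mq = 0") auto
  qed auto
  also have "\<dots> = (\<Sum>m=1..N. f m * (\<Sum>q | m * q \<in> I. primepow_log f q))"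
    using finite_mult_vimage[OF fin_I] by (subst sum.Sigma[symmetric]) (auto simp: sum_distrib_left)
  also have "\<dots> \<le> (\<Sum>m=1..N. f m * B)"
    using nonneg inner by (intro sum_mono mult_left_mono) auto
  finally show ?thesis by (simp add: sum_distrib_right)
qed

lemma sum_le_sum_dyadic_blocks:
  fixes w :: "nat \<Rightarrow> real"
  assumes "y > 0" "finite Q" "\<And>q. q \<in> Q \<Longrightarrow> y < real q \<and> real q \<le> 2 ^ J * y"
    and "\<And>j. j < J \<Longrightarrow> (\<Sum>q | q \<in> Q \<and> 2 ^ j * y < real q \<and> real q \<le> 2 * (2 ^ j * y). w q) \<le> b j"
  shows "sum w Q \<le> (\<Sum>j<J. b j)"
  using assms(2-)
proof (induction J arbitrary: Q)
  case 0
  hence "Q = {}" by force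
  thus ?case by simp
next
  case (Suc J)
  define lower where "lower = {q \<in> Q. real q \<le> 2 ^ J * y}"
  define upper where "upper = {q \<in> Q. 2 ^ J * y < real q}"
  have "sum w lower \<le> (\<Sum>j<J. b j)"
  proof (rule Suc.IH)
    fix j assume "j < J"
    hence "(2 :: real) * 2 ^ j \<le> 2 ^ J" using power_increasing[of "Suc j" J "2 :: real"] by simp
    from mult_right_mono[OF this, of y] have "2 * (2 ^ j * y) \<le> 2 ^ J * y" using \<open>y > 0\<close> by simp
    hence "{q. q \<in> lower \<and> 2 ^ j * y < real q \<and> real q \<le> 2 * (2 ^ j * y)} =
        {q. q \<in> Q \<and> 2 ^ j * y < real q \<and> real q \<le> 2 * (2 ^ j * y)}"
      by (auto simp: lower_def)
    thus "(\<Sum>q | q \<in> lower \<and> 2 ^ j * y < real q \<and> real q \<le> 2 * (2 ^ j * y). w q) \<le> b j"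
      using Suc.prems(3)[of j] \<open>j < J\<close> by simp
  qed (use Suc.prems in \<open>auto simp: lower_def\<close>)
  moreover have "upper = {q. q \<in> Q \<and> 2 ^ J * y < real q \<and> real q \<le> 2 * (2 ^ J * y)}"
    using Suc.prems(2) by (auto simp: upper_def mult.assoc)
  hence "sum w upper \<le> b J" using Suc.prems(3)[of J] by simp
  moreover have "sum w Q = sum w lower + sum w upper"
    unfolding lower_def upper_def using Suc.prems(1)
    by (subst sum.union_disjoint[symmetric]) (auto intro: sum.cong)
  ultimately show ?case by simp
qed

context
  fixes w :: "nat \<Rightarrow> real" and C :: real
  assumes nonneg: "\<And>n. w n \<ge> 0"
    and linear: "\<And>y. y \<ge> 2 \<Longrightarrow> (\<Sum>n | 1 \<le> n \<and> real n \<le> y. w n) \<le> C * y"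
begin

lemma sum_div_dyadic_block_le:
  assumes "finite Q" "\<And>q. q \<in> Q \<Longrightarrow> y < real q \<and> real q \<le> 2 * y" "y \<ge> 1"
  shows "(\<Sum>q\<in>Q. w q / real q) \<le> 2 * C"
proof -
  have "(\<Sum>q\<in>Q. w q / real q) \<le> (\<Sum>q\<in>Q. w q / y)"
    using assms(2,3) nonneg by (intro sum_mono divide_left_mono) force+
  also have "\<dots> = (\<Sum>q\<in>Q. w q) / y" by (simp add: sum_divide_distrib)
  also have "(\<Sum>q\<in>Q. w q) \<le> (\<Sum>n | 1 \<le> n \<and> real n \<le> 2 * y. w n)"
    using assms nonneg by (intro sum_mono2) force+
  also have "\<dots> \<le> C * (2 * y)" using assms by (intro linear) auto
  finally show ?thesis using \<open>y \<ge> 1\<close> by (simp add: divide_right_mono field_simps)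
qed

lemma sum_div_interval_le:
  assumes "1 \<le> y" "y \<le> z"
  shows "(\<Sum>q | y < real q \<and> real q \<le> z. w q / real q) \<le> 2 * C * (2 * ln (z / y) + 1)"
proof -
  define J where "J = nat \<lceil>log 2 (z / y)\<rceil>"
  let ?Q = "{q. y < real q \<and> real q \<le> z}"
  have "log 2 (z / y) \<le> real J" unfolding J_def by (rule real_nat_ceiling_ge)
  hence z_le: "z \<le> 2 ^ J * y" using assms by (simp add: log_le_iff powr_realpow divide_le_eq)
  have "log 2 (z / y) \<le> 2 * ln (z / y)"
    using assms ln2_ge_two_thirds mult_left_mono[of "1/2" "ln 2" "ln (z / y)"]
    by (simp add: log_def divide_le_eq)
  moreover have "real J \<le> log 2 (z / y) + 1"
    using assms unfolding J_def by (simp add: of_nat_ceiling)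
  ultimately have J_le: "real J \<le> 2 * ln (z / y) + 1" by linarith
  have "(\<Sum>q\<in>?Q. w q / real q) \<le> (\<Sum>j<J. 2 * C)"
  proof (rule sum_le_sum_dyadic_blocks[where y = y])
    fix j
    have "2 ^ j * y \<ge> 1" using assms mult_mono[of 1 "2 ^ j" 1 y] by simp
    thus "(\<Sum>q | q \<in> ?Q \<and> 2 ^ j * y < real q \<and> real q \<le> 2 * (2 ^ j * y). w q / real q) \<le> 2 * C"
      by (intro sum_div_dyadic_block_le[of _ "2 ^ j * y"]) auto
  qed (use assms z_le in auto)
  also have "\<dots> = 2 * C * real J" by simp
  also have "\<dots> \<le> 2 * C * (2 * ln (z / y) + 1)"
    using J_le sum_div_dyadic_block_le[of "{}" 1] by (intro mult_left_mono) auto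
  finally show ?thesis .
qed

lemma sum_dirichlet_term_dyadic_block_le:
  assumes "finite Q" "\<And>q. q \<in> Q \<Longrightarrow> 2 ^ j < real q \<and> real q \<le> 2 * 2 ^ j" "\<sigma> > 0"
  shows "(\<Sum>q\<in>Q. dirichlet_term w \<sigma> q) \<le> 2 * C * (2 powr (- \<sigma>)) ^ j"
proof -
  have "(2 powr (- \<sigma>)) ^ j = ((2 :: real) ^ j) powr (- \<sigma>)"
    by (simp add: powr_powr powr_realpow[symmetric] mult_ac powr_power)
  hence "real q powr (- \<sigma>) \<le> (2 powr (- \<sigma>)) ^ j" if "q \<in> Q" for q
    using assms(2)[OF that] \<open>\<sigma> > 0\<close> by (auto intro!: powr_mono2')
  hence "(\<Sum>q\<in>Q. dirichlet_term w \<sigma> q) \<le> (\<Sum>q\<in>Q. w q / real q * (2 powr (- \<sigma>)) ^ j)"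
    unfolding dirichlet_term_def using nonneg by (intro sum_mono mult_mono) auto
  also have "\<dots> = (\<Sum>q\<in>Q. w q / real q) * (2 powr (- \<sigma>)) ^ j" by (simp add: sum_distrib_right)
  also have "\<dots> \<le> 2 * C * (2 powr (- \<sigma>)) ^ j"
    using assms by (intro mult_right_mono sum_div_dyadic_block_le[of _ "2 ^ j"]) auto
  finally show ?thesis .
qed

lemma sum_dirichlet_term_le:
  assumes "finite Q" "\<And>q. q \<in> Q \<Longrightarrow> q > 1" "\<sigma> > 0"
  shows "(\<Sum>q\<in>Q. dirichlet_term w \<sigma> q) \<le> C * (2 + 4 / \<sigma>)"
proof -
  define r where "r = (2::real) powr (- \<sigma>)"
  have C_nonneg: "C \<ge> 0" using sum_div_dyadic_block_le[of "{}" 1] by simp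
  have r_bounds: "0 < r" "r < 1" "1 / (1 - r) \<le> 1 + 2 / \<sigma>"
  proof -
    have "1 / r = exp (\<sigma> * ln 2)" by (simp add: r_def powr_def exp_minus field_simps)
    moreover have "\<sigma> / 2 \<le> \<sigma> * ln 2" using \<open>\<sigma> > 0\<close> ln2_ge_two_thirds by simp
    ultimately have "1 + \<sigma> / 2 \<le> 1 / r" using exp_ge_add_one_self[of "\<sigma> * ln 2"] by linarith
    thus "0 < r" "r < 1" "1 / (1 - r) \<le> 1 + 2 / \<sigma>"
      using \<open>\<sigma> > 0\<close> by (auto simp: r_def field_simps powr_less_one)
  qed
  obtain J where Max_less: "real (Max (insert 0 Q)) < 2 ^ J"
    using real_arch_pow[of 2 "real (Max (insert 0 Q))"] by auto
  have "(\<Sum>q\<in>Q. dirichlet_term w \<sigma> q) \<le> (\<Sum>j<J. 2 * C * r ^ j)"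
  proof (rule sum_le_sum_dyadic_blocks[where y = 1])
    fix q assume "q \<in> Q"
    hence "q \<le> Max (insert 0 Q)" using assms(1) by simp
    thus "1 < real q \<and> real q \<le> 2 ^ J * 1" using assms(2)[OF \<open>q \<in> Q\<close>] Max_less by simp
  qed (use assms in \<open>auto simp: r_def intro!: sum_dirichlet_term_dyadic_block_le\<close>)
  also have "\<dots> = 2 * C * ((1 - r ^ J) / (1 - r))"
    using r_bounds by (simp add: sum_distrib_left[symmetric] sum_gp_strict)
  also have "\<dots> \<le> 2 * C * (1 + 2 / \<sigma>)"
    using C_nonneg r_bounds
    by (intro mult_left_mono order.trans[OF divide_right_mono r_bounds(3)]) auto
  finally show ?thesis by (simp add: algebra_simps)
qed

end

subsection \<open>The dominating function\<close>

locale chebyshev_multiplicative =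
  fixes g :: "nat \<Rightarrow> real" and \<beta> C :: real
  assumes g_mult: "multiplicative g"
    and g_nonneg: "g n \<ge> 0"
    and g_prime_le: "prime p \<Longrightarrow> g p \<le> \<beta>"
    and g_higher_summable: "(\<lambda>q. g q / real q) summable_on {q. \<exists>p k. prime p \<and> k \<ge> 2 \<and> q = p ^ k}"
    and g_chebyshev: "y \<ge> 2 \<Longrightarrow> (\<Sum>q | primepow q \<and> real q \<le> y. g q * ln (real q)) \<le> C * y"
begin

lemma sum_primepow_log_le:
  assumes "y \<ge> 2"
  shows "(\<Sum>n | 1 \<le> n \<and> real n \<le> y. primepow_log g n) \<le> C * y"
proof -
  have "(\<Sum>n | 1 \<le> n \<and> real n \<le> y. primepow_log g n) =
      (\<Sum>q | primepow q \<and> real q \<le> y. g q * ln (real q))"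
    by (rule sum.mono_neutral_cong_right) (auto simp: primepow_log_def Suc_le_eq primepow_gt_0_nat)
  thus ?thesis using g_chebyshev[OF assms] by simp
qed

lemma C_nonneg: "C \<ge> 0"
  using sum_div_dyadic_block_le[OF primepow_log_nonneg[OF g_nonneg] sum_primepow_log_le, of "{}" 1]
  by simp

lemma sum_primepow_log_div_interval_le:
  assumes "0 < y" "y \<le> z"
  shows "(\<Sum>q | y < real q \<and> real q \<le> z. primepow_log g q / real q) \<le>
    2 * C * (2 * ln (z / y) + 1)"
proof (cases "1 \<le> z")
  case True
  have "(\<Sum>q | y < real q \<and> real q \<le> z. primepow_log g q / real q) =
      (\<Sum>q | max 1 y < real q \<and> real q \<le> z. primepow_log g q / real q)"
    using gt_1_if_primepow_log_neq_0[of g] by (intro sum.mono_neutral_right) auto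
  also have "\<dots> \<le> 2 * C * (2 * ln (z / max 1 y) + 1)"
    using True assms
    by (intro sum_div_interval_le primepow_log_nonneg g_nonneg sum_primepow_log_le) auto
  also have "\<dots> \<le> 2 * C * (2 * ln (z / y) + 1)"
    using True assms C_nonneg
    by (intro mult_left_mono add_right_mono) (auto intro!: divide_left_mono)
  finally show ?thesis .
next
  case False
  have "(\<Sum>q | y < real q \<and> real q \<le> z. primepow_log g q / real q) = 0"
    using False gt_1_if_primepow_log_neq_0[of g] by (intro sum.neutral) force
  thus ?thesis using assms C_nonneg by simp
qed

lemma \<beta>_nonneg: "\<beta> \<ge> 0"
  using g_nonneg[of 2] g_prime_le[of 2] by simp

lemma sum_dirichlet_term_primepow_log_le:
  assumes "finite Q" "\<sigma> > 0"
  shows "(\<Sum>q\<in>Q. dirichlet_term (primepow_log g) \<sigma> q) \<le> C * (2 + 4 / \<sigma>)"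
proof -
  have "(\<Sum>q\<in>Q. dirichlet_term (primepow_log g) \<sigma> q) =
      (\<Sum>q\<in>Q \<inter> {1<..}. dirichlet_term (primepow_log g) \<sigma> q)"
    using assms(1) gt_1_if_primepow_log_neq_0[of g]
    by (intro sum.mono_neutral_right) (auto simp: dirichlet_term_def)
  also have "\<dots> \<le> C * (2 + 4 / \<sigma>)"
    using assms
    by (intro sum_dirichlet_term_le primepow_log_nonneg g_nonneg sum_primepow_log_le) auto
  finally show ?thesis .
qed

lemma dirichlet_term_g_nonneg: "dirichlet_term g \<sigma> n \<ge> 0"
  by (rule dirichlet_term_nonneg) (rule g_nonneg)

lemma log_sum_g_ge_1: "x \<ge> 1 \<Longrightarrow> log_sum g x \<ge> 1"
  using sum_mono2[of "{n. 1 \<le> n \<and> real n \<le> x}" "{1}" "\<lambda>n. g n / real n"] g_mult g_nonneg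
  by (auto simp: log_sum_def multiplicative_1)

lemma sum_dirichlet_term_g_mult_ln_le:
  assumes "\<sigma> > 0"
  shows "(\<Sum>n=1..N. dirichlet_term g \<sigma> n * ln (real n)) \<le>
    (\<Sum>n=1..N. dirichlet_term g \<sigma> n) * (C * (2 + 4 / \<sigma>))"
proof (rule sum_mult_ln_le
    [OF multiplicative_dirichlet_term[OF g_mult] dirichlet_term_g_nonneg order.refl])
  fix m assume "m \<in> {1..N}"
  thus "(\<Sum>q | m * q \<in> {1..N}. primepow_log (dirichlet_term g \<sigma>) q) \<le> C * (2 + 4 / \<sigma>)"
    using sum_dirichlet_term_primepow_log_le[OF finite_mult_vimage assms, of "{1..N}" m]
    by (simp add: dirichlet_term_primepow_log)
qed

lemma sum_dirichlet_term_g_le: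
  assumes "\<sigma> > 0" "y > 1" "2 * (C * (2 + 4 / \<sigma>)) \<le> ln y"
  shows "(\<Sum>n<N. dirichlet_term g \<sigma> n) \<le> 2 * log_sum g y"
proof -
  let ?t = "dirichlet_term g \<sigma>"
  let ?small = "{n \<in> {1..N}. real n \<le> y}" and ?large = "{n \<in> {1..N}. y < real n}"
  have small_large: "(\<Sum>n=1..N. ?t n) = sum ?t ?small + sum ?t ?large"
    by (subst sum.union_disjoint[symmetric]) (auto intro: sum.cong)
  have "ln y * sum ?t ?large \<le> (\<Sum>n\<in>?large. ?t n * ln (real n))"
    unfolding sum_distrib_left mult.commute[of "ln y"]
    using \<open>y > 1\<close> dirichlet_term_g_nonneg by (intro sum_mono mult_left_mono) auto
  also have "\<dots> \<le> (\<Sum>n=1..N. ?t n * ln (real n))"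
    using dirichlet_term_g_nonneg by (intro sum_mono2) auto
  also have "\<dots> \<le> (\<Sum>n=1..N. ?t n) * (C * (2 + 4 / \<sigma>))"
    by (rule sum_dirichlet_term_g_mult_ln_le[OF assms(1)])
  also have "\<dots> \<le> (\<Sum>n=1..N. ?t n) * (ln y / 2)"
  proof (rule mult_left_mono)
    show "C * (2 + 4 / \<sigma>) \<le> ln y / 2" using assms(3) by linarith
  qed (intro sum_nonneg dirichlet_term_g_nonneg)
  finally have "2 * sum ?t ?large \<le> (\<Sum>n=1..N. ?t n)"
    using \<open>y > 1\<close> by (simp add: field_simps)
  with small_large have "(\<Sum>n=1..N. ?t n) \<le> 2 * sum ?t ?small" by linarith
  moreover have "sum ?t ?small \<le> (\<Sum>n\<in>?small. g n / real n)"
    using norm_dirichlet_term_le[of _ g g 0 \<sigma>] g_nonneg \<open>\<sigma> > 0\<close>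
    by (intro sum_mono) (auto simp: dirichlet_term_zero_exponent abs_le_iff)
  moreover have "\<dots> \<le> log_sum g y"
    unfolding log_sum_def using g_nonneg by (auto intro!: sum_mono2)
  moreover have "(\<Sum>n<N. ?t n) \<le> (\<Sum>n=1..N. ?t n)"
    using dirichlet_term_g_nonneg
    by (subst sum.mono_neutral_right[of _ "{1..<N}"]) (auto intro!: sum_mono2 simp: not_le)
  ultimately show ?thesis by linarith
qed

lemma summable_dirichlet_term_g:
  assumes "\<sigma> > 0"
  shows "summable (dirichlet_term g \<sigma>)"
proof (rule summableI_nonneg_bounded[OF dirichlet_term_g_nonneg sum_dirichlet_term_g_le[OF assms]])
  show "2 * (C * (2 + 4 / \<sigma>)) \<le> ln (exp (2 * (C * (2 + 4 / \<sigma>)) + 1))" by simp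
  show "exp (2 * (C * (2 + 4 / \<sigma>)) + 1) > 1"
    using assms C_nonneg by (simp add: add_nonneg_pos)
qed

lemma dirichlet_series_g_le_log_sum:
  assumes "A > 0" "16 * C \<le> A" "x > 0" "A \<le> ln x"
  shows "dirichlet_series g (A / ln x) \<le> 2 * log_sum g x"
  unfolding dirichlet_series_def
proof (rule suminf_le_const[OF summable_dirichlet_term_g sum_dirichlet_term_g_le])
  have ln_pos: "ln x > 0" using assms by linarith
  thus "x > 1" "A / ln x > 0" "A / ln x > 0"
    using assms by auto
  have "8 * C / A * ln x \<le> 1 / 2 * ln x"
    using assms ln_pos by (intro mult_right_mono) (auto simp: divide_le_eq)
  moreover have "2 * (C * (2 + 4 / (A / ln x))) = 4 * C + 8 * C / A * ln x"
    by (simp add: algebra_simps)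
  ultimately show "2 * (C * (2 + 4 / (A / ln x))) \<le> ln x" using assms by linarith
qed

lemma log_sum_g_diff_le:
  assumes "1 < x" "x \<le> z"
  shows "(\<Sum>n | x < real n \<and> real n \<le> z. g n / real n) \<le>
    2 * C * (2 * ln (z / x) + 1) / ln x * log_sum g z"
proof -
  let ?I = "{n. x < real n \<and> real n \<le> z}" and ?B = "2 * C * (2 * ln (z / x) + 1)"
  have nats_le_z: "{n. 1 \<le> n \<and> real n \<le> z} = {1..nat \<lfloor>z\<rfloor>}"
    using assms by (auto simp: le_nat_iff le_floor_iff)
  have "ln x * (\<Sum>n\<in>?I. g n / real n) \<le> (\<Sum>n\<in>?I. dirichlet_term g 0 n * ln (real n))"
    unfolding sum_distrib_left mult.commute[of "ln x"] dirichlet_term_zero_exponent of_nat_id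
    using assms g_nonneg by (intro sum_mono mult_left_mono) auto
  also have "\<dots> \<le> (\<Sum>m=1..nat \<lfloor>z\<rfloor>. dirichlet_term g 0 m) * ?B"
  proof (rule sum_mult_ln_le[OF multiplicative_dirichlet_term[OF g_mult] dirichlet_term_g_nonneg])
    show "?I \<subseteq> {1..nat \<lfloor>z\<rfloor>}" using assms nats_le_z by force
    fix m assume "m \<in> {1..nat \<lfloor>z\<rfloor>}"
    hence "m > 0" by simp
    hence "{q. m * q \<in> ?I} = {q. x / real m < real q \<and> real q \<le> z / real m}"
      by (simp add: divide_less_eq le_divide_eq mult.commute)
    thus "(\<Sum>q | m * q \<in> ?I. primepow_log (dirichlet_term g 0) q) \<le> ?B"
      using sum_primepow_log_div_interval_le[of "x / real m" "z / real m"] assms \<open>m > 0\<close>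
      by (simp add: dirichlet_term_primepow_log[symmetric] dirichlet_term_zero_exponent
          divide_right_mono)
  qed
  also have "\<dots> = log_sum g z * ?B"
    unfolding log_sum_def nats_le_z dirichlet_term_zero_exponent of_nat_id ..
  finally show ?thesis using assms by (simp add: field_simps)
qed

lemma log_sum_g_le_dirichlet_series:
  assumes "\<sigma> > 0" "z \<ge> 1"
  shows "log_sum g z \<le> z powr \<sigma> * dirichlet_series g \<sigma>"
proof -
  have "log_sum g z \<le> (\<Sum>n | 1 \<le> n \<and> real n \<le> z. z powr \<sigma> * dirichlet_term g \<sigma> n)"
    unfolding log_sum_def
  proof (rule sum_mono)
    fix n assume n_le_z: "n \<in> {n. 1 \<le> n \<and> real n \<le> z}"
    have "1 = real n powr \<sigma> * real n powr (- \<sigma>)" using n_le_z by (simp add: powr_add[symmetric])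
    also have "\<dots> \<le> z powr \<sigma> * real n powr (- \<sigma>)"
      using n_le_z assms by (intro mult_right_mono powr_mono2) auto
    finally have "g n / real n * 1 \<le> g n / real n * (z powr \<sigma> * real n powr (- \<sigma>))"
      using g_nonneg by (intro mult_left_mono) auto
    thus "g n / of_nat n \<le> z powr \<sigma> * dirichlet_term g \<sigma> n"
      by (simp add: dirichlet_term_def mult_ac)
  qed
  also have "\<dots> = z powr \<sigma> * (\<Sum>n | 1 \<le> n \<and> real n \<le> z. dirichlet_term g \<sigma> n)"
    by (simp add: sum_distrib_left)
  also have "\<dots> \<le> z powr \<sigma> * dirichlet_series g \<sigma>"
    unfolding dirichlet_series_def using assms
    by (intro mult_left_mono sum_le_suminf summable_dirichlet_term_g dirichlet_term_g_nonneg) auto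
  finally show ?thesis .
qed

end

subsection \<open>Euler factors\<close>

lemma bij_betw_higher_prime_powers:
  "bij_betw (\<lambda>(p, k). p ^ (k + 2)) ({p. prime p} \<times> UNIV)
    {q::nat. \<exists>p k. prime p \<and> k \<ge> 2 \<and> q = p ^ k}"
  unfolding bij_betw_def
proof
  show "inj_on (\<lambda>(p, k). p ^ (k + 2)) ({p::nat. prime p} \<times> UNIV)"
    by (auto simp: inj_on_def prime_power_inj'' simp del: power_Suc add_2_eq_Suc')
  show "(\<lambda>(p, k). p ^ (k + 2)) ` ({p. prime p} \<times> UNIV) =
      {q::nat. \<exists>p k. prime p \<and> k \<ge> 2 \<and> q = p ^ k}"
    (is "?f ` ?D = ?R")
  proof
    have "?f (p, k) \<in> ?R" if "prime p" for p k
      using that by (intro CollectI exI[of _ p] exI[of _ "k + 2"]) simp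
    thus "?f ` ?D \<subseteq> ?R" by blast
    have "p ^ k \<in> ?f ` ?D" if "prime p" "k \<ge> 2" for p k :: nat
      using that by (intro image_eqI[of _ _ "(p, k - 2)"]) (auto simp del: power_Suc add_2_eq_Suc')
    thus "?R \<subseteq> ?f ` ?D" by blast
  qed
qed

definition mult_dominated :: "(nat \<Rightarrow> 'a :: real_normed_field) \<Rightarrow> (nat \<Rightarrow> real) \<Rightarrow> bool" where
  "mult_dominated f g \<longleftrightarrow> multiplicative f \<and> (\<forall>n\<ge>1. norm (f n) \<le> g n)"

lemma norm_dirichlet_term_dominated_le:
  "mult_dominated f g \<Longrightarrow> \<tau> \<le> \<sigma> \<Longrightarrow> norm (dirichlet_term f \<sigma> n) \<le> dirichlet_term g \<tau> n"
  by (rule norm_dirichlet_term_le) (auto simp: mult_dominated_def)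

context chebyshev_multiplicative
begin

definition higher_power_sum :: "nat \<Rightarrow> real" where
  "higher_power_sum p = (\<Sum>k. dirichlet_term g 0 (p ^ (k + 2)))"

lemma mult_dominated_g: "mult_dominated g g"
  using g_mult g_nonneg by (simp add: mult_dominated_def)

lemma summable_on_higher_prime_powers:
  "(\<lambda>(p, k). dirichlet_term g 0 (p ^ (k + 2))) summable_on {p. prime p} \<times> UNIV"
  using summable_on_reindex_bij_betw[OF bij_betw_higher_prime_powers, of "dirichlet_term g 0"]
    g_higher_summable
  by (simp add: dirichlet_term_zero_exponent[abs_def] case_prod_unfold)

lemma summable_higher_powers:
  assumes "prime p"
  shows "summable (\<lambda>k. dirichlet_term g 0 (p ^ (k + 2)))"
  using summable_on_SigmaD1[OF summable_on_higher_prime_powers, of p] assms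
  by (intro summable_on_imp_summable) simp

lemma higher_power_sum_nonneg: "prime p \<Longrightarrow> higher_power_sum p \<ge> 0"
  unfolding higher_power_sum_def
  by (intro suminf_nonneg summable_higher_powers dirichlet_term_g_nonneg)

lemma summable_on_higher_power_sum: "higher_power_sum summable_on {p. prime p}"
proof -
  have "(\<Sum>\<^sub>\<infinity>k. dirichlet_term g 0 (p ^ (k + 2))) = higher_power_sum p" if "prime p" for p
    unfolding higher_power_sum_def using summable_higher_powers[OF that] dirichlet_term_g_nonneg
    by (intro infsumI norm_summable_imp_has_sum summable_sums)
      (auto simp del: power_Suc add_2_eq_Suc')
  with summable_on_Sigma_banach[OF summable_on_higher_prime_powers] show ?thesis
    by (rule summable_on_cong[THEN iffD1, rotated]) simp
qed

lemma summable_norm_dirichlet_term_prime_powers: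
  assumes "mult_dominated f g" "prime p" "\<sigma> \<ge> 0"
  shows "summable (\<lambda>k. norm (dirichlet_term f \<sigma> (p ^ k)))"
proof (rule summable_comparison_test'[where N = 0])
  show "summable (\<lambda>k. dirichlet_term g 0 (p ^ k))"
    using summable_higher_powers[OF assms(2)] by (subst (asm) summable_iff_shift)
qed (use norm_dirichlet_term_dominated_le[OF assms(1,3)] in simp)

lemma summable_dirichlet_term_g_prime_powers:
  "prime p \<Longrightarrow> \<sigma> \<ge> 0 \<Longrightarrow> summable (\<lambda>k. dirichlet_term g \<sigma> (p ^ k))"
  by (rule summable_norm_cancel[OF summable_norm_dirichlet_term_prime_powers[OF mult_dominated_g]])

lemma norm_euler_factor_tail_le:
  fixes f :: "nat \<Rightarrow> 'a :: {real_normed_field, banach}"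
  assumes "mult_dominated f g" "prime p" "\<sigma> \<ge> 0"
  shows "norm (euler_factor f \<sigma> p - 1 - dirichlet_term f \<sigma> p) \<le> higher_power_sum p"
proof -
  let ?a = "\<lambda>k. dirichlet_term f \<sigma> (p ^ k)"
  have abs_summable: "summable (\<lambda>k. norm (?a k))"
    by (rule summable_norm_dirichlet_term_prime_powers[OF assms])
  have "?a 0 = 1" using assms(1) by (simp add: mult_dominated_def dirichlet_term_1)
  hence "euler_factor f \<sigma> p - 1 - dirichlet_term f \<sigma> p = (\<Sum>k. ?a (k + 2))"
    using suminf_split_initial_segment[OF summable_norm_cancel[OF abs_summable], of 2]
    unfolding euler_factor_def by (simp add: numeral_2_eq_2)
  also have "norm \<dots> \<le> (\<Sum>k. norm (?a (k + 2)))"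
    using abs_summable by (intro summable_norm) (subst summable_iff_shift)
  also have "\<dots> \<le> higher_power_sum p"
    unfolding higher_power_sum_def
    using norm_dirichlet_term_dominated_le[OF assms(1,3)] abs_summable
    by (intro suminf_le summable_higher_powers[OF assms(2)]) (assumption, subst summable_iff_shift)
  finally show ?thesis .
qed

lemma euler_factor_g_ge_1:
  assumes "prime p" "\<sigma> \<ge> 0"
  shows "euler_factor g \<sigma> p \<ge> 1"
proof -
  have "(\<Sum>k\<in>{0}. dirichlet_term g \<sigma> (p ^ k)) \<le> euler_factor g \<sigma> p"
    unfolding euler_factor_def
    by (intro sum_le_suminf summable_dirichlet_term_g_prime_powers assms dirichlet_term_g_nonneg)
      auto
  thus ?thesis using g_mult by (simp add: dirichlet_term_1)
qed

lemma norm_euler_factor_le: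
  fixes f :: "nat \<Rightarrow> 'a :: {real_normed_field, banach}"
  assumes "mult_dominated f g" "prime p" "\<sigma> \<ge> 0"
  shows "norm (euler_factor f \<sigma> p) \<le> euler_factor g \<sigma> p"
proof -
  have "norm (euler_factor f \<sigma> p) \<le> (\<Sum>k. norm (dirichlet_term f \<sigma> (p ^ k)))"
    unfolding euler_factor_def
    by (rule summable_norm[OF summable_norm_dirichlet_term_prime_powers[OF assms]])
  also have "\<dots> \<le> euler_factor g \<sigma> p"
    unfolding euler_factor_def
    by (intro suminf_le norm_dirichlet_term_dominated_le summable_norm_dirichlet_term_prime_powers
        summable_dirichlet_term_g_prime_powers assms order.refl)
  finally show ?thesis .
qed

lemma euler_factor_tendsto:
  fixes f :: "nat \<Rightarrow> 'a :: {real_normed_field, banach}"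
  assumes "mult_dominated f g" "prime p"
  shows "((\<lambda>\<sigma>. euler_factor f \<sigma> p) \<longlongrightarrow> euler_factor f 0 p) (at_right 0)"
  unfolding euler_factor_def
proof (rule tannerys_theorem
    [where M = "\<lambda>k. dirichlet_term g 0 (p ^ k)", THEN conjunct2, THEN conjunct2])
  fix k
  have "((\<lambda>\<sigma>. real (p ^ k) powr (- \<sigma>)) \<longlongrightarrow> real (p ^ k) powr (- 0)) (at_right 0)"
    by (intro tendsto_intros) (use prime_gt_0_nat[OF assms(2)] in auto)
  thus "((\<lambda>\<sigma>. dirichlet_term f \<sigma> (p ^ k)) \<longlongrightarrow> dirichlet_term f 0 (p ^ k)) (at_right 0)"
    unfolding dirichlet_term_def
    by (intro tendsto_intros) (use prime_gt_0_nat[OF assms(2)] in simp)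
next
  have "\<forall>\<^sub>F \<sigma> in at_right 0. (\<sigma>::real) \<ge> 0"
    using eventually_at_right_less[of "0::real"] by eventually_elim simp
  thus "\<forall>\<^sub>F (k, \<sigma>) in at_top \<times>\<^sub>F at_right 0.
      norm (dirichlet_term f \<sigma> (p ^ k)) \<le> dirichlet_term g 0 (p ^ k)"
    unfolding eventually_prod_filter
    by (intro exI[of _ "\<lambda>_. True"] exI[of _ "\<lambda>\<sigma>. \<sigma> \<ge> 0"])
       (auto intro: norm_dirichlet_term_dominated_le[OF assms(1)])
qed (use assms summable_dirichlet_term_g_prime_powers in auto)

lemma summable_norm_dirichlet_term:
  assumes "mult_dominated f g" "\<sigma> > 0"
  shows "summable (\<lambda>n. norm (dirichlet_term f \<sigma> n))"
  by (rule summable_comparison_test'[OF summable_dirichlet_term_g[OF assms(2)], where N = 0])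
    (use norm_dirichlet_term_dominated_le[OF assms(1) order.refl] in auto)

lemma dirichlet_series_euler_product:
  fixes f :: "nat \<Rightarrow> 'a :: {real_normed_field, banach}"
  assumes "mult_dominated f g" "\<sigma> > 0"
  shows "((\<lambda>x. \<Prod>p\<in>primes_upto x. euler_factor f \<sigma> p) \<longlongrightarrow> dirichlet_series f \<sigma>) at_top"
  unfolding euler_factor_def dirichlet_series_def
  by (rule euler_product_tendsto)
    (use assms summable_norm_dirichlet_term in
      \<open>auto intro!: multiplicative_dirichlet_term simp: mult_dominated_def\<close>)

lemma dirichlet_series_g_antimono:
  assumes "0 < \<tau>" "\<tau> \<le> \<sigma>"
  shows "dirichlet_series g \<sigma> \<le> dirichlet_series g \<tau>"
  unfolding dirichlet_series_def
  using norm_dirichlet_term_dominated_le[OF mult_dominated_g assms(2)] assms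
  by (intro suminf_le summable_dirichlet_term_g) (auto simp: abs_le_iff)

lemma dirichlet_series_g_ge_1:
  assumes "\<sigma> > 0"
  shows "dirichlet_series g \<sigma> \<ge> 1"
proof -
  have "(\<Sum>n\<in>{1}. dirichlet_term g \<sigma> n) \<le> dirichlet_series g \<sigma>"
    unfolding dirichlet_series_def
    by (intro sum_le_suminf summable_dirichlet_term_g dirichlet_term_g_nonneg assms) auto
  thus ?thesis using g_mult by (simp add: dirichlet_term_1)
qed

end

subsection \<open>The ratio of the Dirichlet series\<close>

lemma sum_tail_less_if_summable_on:
  fixes f :: "nat \<Rightarrow> real"
  assumes f_summable: "f summable_on A" and nonneg: "\<And>n. n \<in> A \<Longrightarrow> f n \<ge> 0" and "e > 0"
  shows "\<exists>y. \<forall>S. finite S \<longrightarrow> S \<subseteq> {n \<in> A. real n > y} \<longrightarrow> sum f S < e"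
proof -
  have "\<forall>\<^sub>F F in finite_subsets_at_top A. dist (sum f F) (infsum f A) < e"
    using has_sum_infsum[OF f_summable] \<open>e > 0\<close> unfolding has_sum_def by (rule tendstoD)
  then obtain F where F_close: "finite F" "F \<subseteq> A" "dist (sum f F) (infsum f A) < e"
    unfolding eventually_finite_subsets_at_top by auto
  hence F_large: "infsum f A - e < sum f F" by (simp add: dist_real_def)
  have "sum f S < e" if S_tail: "finite S" "S \<subseteq> {n \<in> A. real n > real (Max (insert 0 F))}" for S
  proof -
    have "n \<le> Max (insert 0 F)" if "n \<in> F" for n using that F_close(1) by simp
    hence "F \<inter> S = {}" using S_tail(2) by fastforce
    hence "sum f F + sum f S = sum f (F \<union> S)" using F_close S_tail by (simp add: sum.union_disjoint)
    also have "\<dots> \<le> infsum f A" using F_close S_tail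
      by (intro finite_sum_le_infsum f_summable nonneg) auto
    finally show ?thesis using F_large by simp
  qed
  thus ?thesis by blast
qed

lemma summable_on_one_minus_if_prod_bounded_below:
  fixes r :: "'a \<Rightarrow> real"
  assumes r_bounds: "\<And>x. x \<in> A \<Longrightarrow> 0 \<le> r x \<and> r x \<le> 1"
    and "l > 0" and prod_ge: "\<And>F. finite F \<Longrightarrow> F \<subseteq> A \<Longrightarrow> l \<le> prod r F"
  shows "(\<lambda>x. 1 - r x) summable_on A"
proof (rule nonneg_bdd_above_summable_on)
  have "(\<Sum>x\<in>F. 1 - r x) \<le> - ln l" if "finite F" "F \<subseteq> A" for F
  proof -
    have "l \<le> prod r F" by (rule prod_ge[OF that])
    also have "\<dots> \<le> (\<Prod>x\<in>F. exp (- (1 - r x)))"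
    proof (rule prod_mono)
      show "0 \<le> r x \<and> r x \<le> exp (- (1 - r x))" if "x \<in> F" for x
        using r_bounds[of x] \<open>F \<subseteq> A\<close> that exp_ge_add_one_self[of "r x - 1"] by auto
    qed
    also have "\<dots> = exp (- (\<Sum>x\<in>F. 1 - r x))" using that by (simp add: exp_sum sum_negf[symmetric])
    finally have "ln l \<le> - (\<Sum>x\<in>F. 1 - r x)"
      using \<open>l > 0\<close> by (metis exp_gt_zero ln_exp ln_le_cancel_iff)
    thus ?thesis by simp
  qed
  thus "bdd_above (sum (\<lambda>x. 1 - r x) ` {F. F \<subseteq> A \<and> finite F})"
    by (auto intro!: bdd_aboveI2)
qed (use r_bounds in auto)

lemma norm_one_minus_le:
  fixes z :: complex
  shows "norm (1 - z) \<le> 1 - Re z + (norm z)\<^sup>2 / 2"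
proof (rule power2_le_imp_le)
  have "(norm (1 - z))\<^sup>2 = 1 + 2 * ((norm z)\<^sup>2 / 2 - Re z)"
    unfolding cmod_power2 by (simp add: power2_eq_square algebra_simps)
  also have "\<dots> \<le> (1 + ((norm z)\<^sup>2 / 2 - Re z))\<^sup>2"
    by (simp add: power2_sum)
  finally show "(norm (1 - z))\<^sup>2 \<le> (1 - Re z + (norm z)\<^sup>2 / 2)\<^sup>2" by (simp add: algebra_simps)
  have "2 * norm z \<le> 1 + (norm z)\<^sup>2"
    using zero_le_power2[of "1 - norm z"] by (simp add: power2_diff)
  thus "0 \<le> 1 - Re z + (norm z)\<^sup>2 / 2" using complex_Re_le_cmod[of z] norm_ge_zero[of z] by linarith
qed

lemma norm_of_real_diff_le:
  fixes z :: complex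
  assumes "norm z \<le> r" "\<eta> > 0"
  shows "norm (of_real r - z) \<le> \<eta> * r + (r - Re z) / (2 * \<eta>)"
proof (rule power2_le_imp_le)
  have "(norm (of_real r - z))\<^sup>2 = r\<^sup>2 - 2 * r * Re z + (norm z)\<^sup>2"
    unfolding cmod_power2 by (simp add: power2_eq_square algebra_simps)
  also have "\<dots> \<le> 2 * r * (r - Re z)"
    using power_mono[OF assms(1), of 2] by (simp add: power2_eq_square algebra_simps)
  also have "\<dots> = 4 * (\<eta> * r) * ((r - Re z) / (2 * \<eta>))" using assms(2) by simp
  also have "\<dots> \<le> (\<eta> * r + (r - Re z) / (2 * \<eta>))\<^sup>2"
    using zero_le_power2[of "\<eta> * r - (r - Re z) / (2 * \<eta>)"]
    unfolding power2_sum power2_diff by linarith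
  finally show "(norm (of_real r - z))\<^sup>2 \<le> (\<eta> * r + (r - Re z) / (2 * \<eta>))\<^sup>2" .
  show "0 \<le> \<eta> * r + (r - Re z) / (2 * \<eta>)"
    using assms complex_Re_le_cmod[of z] order.trans[OF norm_ge_zero assms(1)] by simp
qed

lemma ln_ge_1: "x \<ge> exp 1 \<Longrightarrow> ln x \<ge> (1::real)"
  by (simp add: ln_ge_iff less_le_trans[OF exp_gt_zero])

lemma filterlim_divide_ln_at_right_0:
  assumes "c > (0::real)"
  shows "filterlim (\<lambda>x. c / ln x) (at_right 0) at_top"
proof (rule tendsto_imp_filterlim_at_right)
  show "((\<lambda>x. c / ln x) \<longlongrightarrow> 0) at_top"
    by (intro tendsto_divide_0[OF tendsto_const] filterlim_at_top_imp_at_infinity ln_at_top)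
  show "\<forall>\<^sub>F x in at_top. c / ln x > 0"
    using eventually_gt_at_top[of 1] by eventually_elim (use assms in auto)
qed

locale dominated_multiplicative = chebyshev_multiplicative +
  fixes h :: "nat \<Rightarrow> complex"
  assumes mult_dominated_h: "mult_dominated h g"
begin

definition euler_ratio :: "real \<Rightarrow> nat \<Rightarrow> complex" where
  "euler_ratio \<sigma> p = euler_factor h \<sigma> p / complex_of_real (euler_factor g \<sigma> p)"

definition ratio_prod :: "real \<Rightarrow> real \<Rightarrow> complex" where
  "ratio_prod \<sigma> x = (\<Prod>p\<in>primes_upto x. euler_ratio \<sigma> p)"

definition dirichlet_ratio :: "real \<Rightarrow> complex" where
  "dirichlet_ratio \<sigma> = dirichlet_series h \<sigma> / complex_of_real (dirichlet_series g \<sigma>)"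

definition gap :: "nat \<Rightarrow> complex" where
  "gap p = (complex_of_real (g p) - h p) / of_nat p"

definition first_order_error :: "nat \<Rightarrow> real" where
  "first_order_error p = 2 * \<beta>\<^sup>2 / real p ^ 2 + (2 + 2 * \<beta>) * higher_power_sum p"

lemma norm_h_le: "n \<ge> 1 \<Longrightarrow> norm (h n) \<le> g n"
  using mult_dominated_h by (simp add: mult_dominated_def)

lemma norm_gap_le:
  assumes "prime p"
  shows "norm (gap p) \<le> 2 * \<beta> / real p"
proof -
  have "norm (complex_of_real (g p) - h p) \<le> g p + g p"
    using norm_triangle_ineq4[of "complex_of_real (g p)" "h p"] norm_h_le[of p] g_nonneg[of p]
      prime_ge_1_nat[OF assms] by simp
  thus ?thesis
    using g_prime_le[OF assms] by (simp add: gap_def norm_divide divide_right_mono)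
qed

lemma Re_gap_nonneg: "prime p \<Longrightarrow> Re (gap p) \<ge> 0"
  using order.trans[OF complex_Re_le_cmod norm_h_le[OF prime_ge_1_nat]] by (simp add: gap_def)

lemma norm_gap_le_Re_gap:
  assumes "prime p" "\<eta> > 0"
  shows "norm (gap p) \<le> \<eta> * (g p / real p) + Re (gap p) / (2 * \<eta>)"
proof -
  have "norm (complex_of_real (g p) - h p) / real p \<le>
      (\<eta> * g p + (g p - Re (h p)) / (2 * \<eta>)) / real p"
    using assms norm_h_le[of p] prime_ge_1_nat[of p]
    by (intro divide_right_mono norm_of_real_diff_le) auto
  thus ?thesis by (simp add: gap_def norm_divide add_divide_distrib mult_ac)
qed

lemma first_order_error_nonneg: "prime p \<Longrightarrow> first_order_error p \<ge> 0"
  using \<beta>_nonneg higher_power_sum_nonneg by (simp add: first_order_error_def)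

lemma summable_on_first_order_error: "first_order_error summable_on {p. prime p}"
proof -
  have "summable (\<lambda>p. 1 / real p ^ 2)"
    using inverse_power_summable[of 2, where 'a = real] by (simp add: inverse_eq_divide)
  hence "(\<lambda>p. 1 / real p ^ 2) summable_on UNIV"
    using summable_on_UNIV_nonneg_real_iff[of "\<lambda>p. 1 / real p ^ 2"] by simp
  hence "(\<lambda>p. 2 * \<beta>\<^sup>2 * (1 / real p ^ 2)) summable_on {p. prime p}"
    by (rule summable_on_cmult_right[OF summable_on_subset_banach]) simp
  thus ?thesis
    unfolding first_order_error_def[abs_def]
    by (intro summable_on_add summable_on_cmult_right summable_on_higher_power_sum) simp
qed

lemma euler_factor_g_le:
  assumes "prime p" "\<sigma> \<ge> 0"
  shows "euler_factor g \<sigma> p \<le> 1 + \<beta> / real p + higher_power_sum p"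
proof -
  have "g p * real p powr (- \<sigma>) \<le> \<beta> * 1"
    using assms g_prime_le g_nonneg \<beta>_nonneg prime_ge_1_nat[of p]
    by (intro mult_mono powr_uminus_le_1) auto
  hence "dirichlet_term g \<sigma> p \<le> \<beta> / real p"
    by (simp add: dirichlet_term_def divide_right_mono)
  thus ?thesis
    using norm_euler_factor_tail_le[OF mult_dominated_g assms] by (simp add: abs_le_iff)
qed

lemma norm_euler_factor_diff_le:
  assumes "prime p" "\<sigma> \<ge> 0"
  shows "norm (gap p * of_real (real p powr (- \<sigma>)) -
    (of_real (euler_factor g \<sigma> p) - euler_factor h \<sigma> p)) \<le> 2 * higher_power_sum p"
proof -
  let ?tail_g = "euler_factor g \<sigma> p - 1 - dirichlet_term g \<sigma> p"
  let ?tail_h = "euler_factor h \<sigma> p - 1 - dirichlet_term h \<sigma> p"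
  have "norm (complex_of_real ?tail_g) \<le> higher_power_sum p"
    using norm_euler_factor_tail_le[OF mult_dominated_g assms] unfolding norm_of_real by simp
  with norm_euler_factor_tail_le[OF mult_dominated_h assms]
  have "norm (?tail_h - complex_of_real ?tail_g) \<le> higher_power_sum p + higher_power_sum p"
    by (rule order.trans[OF norm_triangle_ineq4 add_mono])
  thus ?thesis by (simp add: gap_def dirichlet_term_def algebra_simps diff_divide_distrib)
qed

lemma euler_ratio_first_order:
  assumes "prime p" "\<sigma> \<ge> 0"
  shows "norm (euler_ratio \<sigma> p - (1 - gap p * of_real (real p powr (- \<sigma>)))) \<le> first_order_error p"
proof -
  define T where "T = higher_power_sum p"
  define D where "D = euler_factor g \<sigma> p"
  define E where "E = of_real D - euler_factor h \<sigma> p"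
  define a where "a = gap p * complex_of_real (real p powr (- \<sigma>))"
  have p_ge_1: "real p \<ge> 1" using prime_ge_1_nat[OF assms(1)] by simp
  have T_nonneg: "T \<ge> 0" using higher_power_sum_nonneg[OF assms(1)] by (simp add: T_def)
  have D_bounds: "D \<ge> 1" "D - 1 \<le> \<beta> / real p + T"
    using euler_factor_g_ge_1[OF assms] euler_factor_g_le[OF assms] by (simp_all add: D_def T_def)
  have norm_a_le: "norm a \<le> 2 * \<beta> / real p"
    using norm_gap_le[OF assms(1)]
      mult_left_le[OF powr_uminus_le_1[OF p_ge_1 assms(2)], of "norm (gap p)"]
    by (simp add: a_def norm_mult)
  have "euler_factor h \<sigma> p = of_real D - E" by (simp add: E_def)
  hence "euler_ratio \<sigma> p - (1 - a) = ((a - E) + a * of_real (D - 1)) / of_real D"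
    using D_bounds by (simp add: euler_ratio_def flip: D_def) (simp add: divide_simps algebra_simps)
  also have "norm \<dots> \<le> norm ((a - E) + a * of_real (D - 1))"
    using D_bounds mult_left_mono[of 1 D "norm (a - E + a * of_real (D - 1))"]
    by (simp add: norm_divide divide_le_eq del: of_real_diff)
  also have "\<dots> \<le> norm (a - E) + norm a * (D - 1)"
    using D_bounds norm_triangle_ineq[of "a - E" "a * of_real (D - 1)"]
    by (simp add: norm_mult del: of_real_diff)
  also have "\<dots> \<le> 2 * T + 2 * \<beta> / real p * (\<beta> / real p + T)"
    using norm_euler_factor_diff_le[OF assms] D_bounds norm_a_le \<beta>_nonneg T_nonneg
    by (intro add_mono mult_mono) (auto simp: a_def E_def D_def T_def)
  also have "\<dots> = 2 * \<beta>\<^sup>2 / real p ^ 2 + (2 * T + 2 * (\<beta> / real p * T))"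
    by (simp add: distrib_left power2_eq_square)
  also have "\<dots> \<le> 2 * \<beta>\<^sup>2 / real p ^ 2 + (2 * T + 2 * (\<beta> * T))"
    using p_ge_1 T_nonneg \<beta>_nonneg mult_left_mono[of 1 "real p" \<beta>]
    by (intro add_left_mono mult_left_mono mult_right_mono) (auto simp: divide_le_eq)
  also have "\<dots> = first_order_error p" by (simp add: first_order_error_def T_def algebra_simps)
  finally show ?thesis by (simp add: a_def)
qed

lemma euler_ratio_0_first_order:
  "prime p \<Longrightarrow> norm (euler_ratio 0 p - (1 - gap p)) \<le> first_order_error p"
  using euler_ratio_first_order[of p 0] prime_gt_0_nat[of p] by simp

lemma Re_gap_le:
  assumes "prime p"
  shows "Re (gap p) \<le> (1 - norm (euler_ratio 0 p)) + 2 * first_order_error p"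
proof -
  have "norm (1 - gap p) \<le> 1 - Re (gap p) + (norm (gap p))\<^sup>2 / 2" by (rule norm_one_minus_le)
  moreover have "(norm (gap p))\<^sup>2 \<le> 4 * \<beta>\<^sup>2 / real p ^ 2"
    using power_mono[OF norm_gap_le[OF assms], of 2]
    by (simp add: power_divide power_mult_distrib)
  moreover have "2 * \<beta>\<^sup>2 / real p ^ 2 \<le> first_order_error p"
    using higher_power_sum_nonneg[OF assms] \<beta>_nonneg by (simp add: first_order_error_def)
  moreover have "norm (euler_ratio 0 p) \<le> norm (1 - gap p) + first_order_error p"
    using euler_ratio_0_first_order[OF assms] norm_triangle_sub[of "euler_ratio 0 p" "1 - gap p"]
    by linarith
  ultimately show ?thesis by linarith
qed

lemma norm_euler_ratio_le_1:
  assumes "prime p" "\<sigma> \<ge> 0"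
  shows "norm (euler_ratio \<sigma> p) \<le> 1"
  using norm_euler_factor_le[OF mult_dominated_h assms] euler_factor_g_ge_1[OF assms]
  by (simp add: euler_ratio_def norm_divide divide_le_eq)

lemma euler_ratio_tendsto:
  assumes "prime p"
  shows "((\<lambda>\<sigma>. euler_ratio \<sigma> p) \<longlongrightarrow> euler_ratio 0 p) (at_right 0)"
  unfolding euler_ratio_def
  by (intro tendsto_intros euler_factor_tendsto mult_dominated_g mult_dominated_h assms)
     (use euler_factor_g_ge_1[OF assms, of 0] in auto)

lemma ratio_prod_tendsto_dirichlet_ratio:
  assumes "\<sigma> > 0"
  shows "(ratio_prod \<sigma> \<longlongrightarrow> dirichlet_ratio \<sigma>) at_top"
proof -
  have "((\<lambda>x. (\<Prod>p\<in>primes_upto x. euler_factor h \<sigma> p) /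
      complex_of_real (\<Prod>p\<in>primes_upto x. euler_factor g \<sigma> p)) \<longlongrightarrow> dirichlet_ratio \<sigma>) at_top"
    unfolding dirichlet_ratio_def using dirichlet_series_g_ge_1[OF assms] assms
    by (intro tendsto_divide tendsto_of_real dirichlet_series_euler_product
        mult_dominated_g mult_dominated_h) auto
  thus ?thesis by (simp add: ratio_prod_def[abs_def] euler_ratio_def prod_dividef)
qed

lemma norm_prod_euler_ratio_antimono:
  assumes "finite B" "A \<subseteq> B" "\<And>p. p \<in> B \<Longrightarrow> prime p" "\<sigma> \<ge> 0"
  shows "norm (\<Prod>p\<in>B. euler_ratio \<sigma> p) \<le> norm (\<Prod>p\<in>A. euler_ratio \<sigma> p)"
proof -
  have "norm (\<Prod>p\<in>B - A. euler_ratio \<sigma> p) \<le> 1"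
    unfolding prod_norm[symmetric] using assms
    by (intro prod_le_1) (auto simp: norm_euler_ratio_le_1)
  thus ?thesis
    using prod.subset_diff[OF assms(2,1), of "euler_ratio \<sigma>"]
    by (simp add: norm_mult mult_left_le_one_le)
qed

lemma norm_ratio_prod_antimono:
  "x \<le> y \<Longrightarrow> \<sigma> \<ge> 0 \<Longrightarrow> norm (ratio_prod \<sigma> y) \<le> norm (ratio_prod \<sigma> x)"
  unfolding ratio_prod_def by (intro norm_prod_euler_ratio_antimono primes_upto_mono) auto

lemma norm_ratio_prod_le_1: "\<sigma> \<ge> 0 \<Longrightarrow> norm (ratio_prod \<sigma> x) \<le> 1"
  unfolding ratio_prod_def using norm_prod_euler_ratio_antimono[of "primes_upto x" "{}"] by auto

lemma norm_dirichlet_ratio_le: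
  assumes "\<sigma> > 0"
  shows "norm (dirichlet_ratio \<sigma>) \<le> norm (ratio_prod \<sigma> x)"
proof (rule Lim_norm_ubound[OF _ ratio_prod_tendsto_dirichlet_ratio[OF assms]])
  show "\<forall>\<^sub>F y in at_top. norm (ratio_prod \<sigma> y) \<le> norm (ratio_prod \<sigma> x)"
    using eventually_ge_at_top[of x]
    by eventually_elim (use assms in \<open>simp add: norm_ratio_prod_antimono\<close>)
qed simp

lemma dirichlet_ratio_minus_ratio_prod_tendsto_0_if_vanishing:
  assumes "c > 0" and vanishing: "\<And>e. e > 0 \<Longrightarrow> \<exists>x. norm (ratio_prod 0 x) < e"
  shows "((\<lambda>x. dirichlet_ratio (c / ln x) - ratio_prod 0 x) \<longlongrightarrow> 0) at_top"
proof (rule tendstoI)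
  fix e :: real assume "e > 0"
  then obtain y where ratio_prod_y: "norm (ratio_prod 0 y) < e / 2"
    using vanishing[of "e / 2"] by auto
  have "((\<lambda>\<sigma>. norm (ratio_prod \<sigma> y)) \<longlongrightarrow> norm (ratio_prod 0 y)) (at_right 0)"
    unfolding ratio_prod_def by (intro tendsto_intros euler_ratio_tendsto) auto
  hence "\<forall>\<^sub>F \<sigma> in at_right 0. norm (ratio_prod \<sigma> y) < e / 2"
    using ratio_prod_y by (rule order_tendstoD)
  hence "\<forall>\<^sub>F x in at_top. norm (ratio_prod (c / ln x) y) < e / 2"
    using filterlim_divide_ln_at_right_0[OF \<open>c > 0\<close>] by (rule eventually_compose_filterlim)
  thus "\<forall>\<^sub>F x in at_top. dist (dirichlet_ratio (c / ln x) - ratio_prod 0 x) 0 < e"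
    using eventually_ge_at_top[of y] eventually_gt_at_top[of 1]
  proof eventually_elim
    case (elim x)
    have "norm (dirichlet_ratio (c / ln x)) \<le> norm (ratio_prod (c / ln x) y)"
      using elim \<open>c > 0\<close> by (intro norm_dirichlet_ratio_le) auto
    moreover have "norm (ratio_prod 0 x) \<le> norm (ratio_prod 0 y)"
      using elim by (intro norm_ratio_prod_antimono) auto
    moreover have "norm (dirichlet_ratio (c / ln x) - ratio_prod 0 x) \<le>
        norm (dirichlet_ratio (c / ln x)) + norm (ratio_prod 0 x)"
      by (rule norm_triangle_ineq4)
    ultimately show ?case using elim ratio_prod_y by simp
  qed
qed

lemma summable_on_Re_gap:
  assumes "l > 0" and norm_ge: "\<And>x. norm (ratio_prod 0 x) \<ge> l"
  shows "(\<lambda>p. Re (gap p)) summable_on {p. prime p}"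
proof (rule summable_on_comparison_test)
  have "(\<lambda>p. 1 - norm (euler_ratio 0 p)) summable_on {p. prime p}"
  proof (rule summable_on_one_minus_if_prod_bounded_below[OF _ \<open>l > 0\<close>])
    fix F :: "nat set" assume primes: "finite F" "F \<subseteq> {p. prime p}"
    have "p \<le> Max (insert 0 F)" if "p \<in> F" for p using primes(1) that by simp
    hence "F \<subseteq> primes_upto (real (Max (insert 0 F)))" using primes by (auto simp: primes_upto_def)
    hence "norm (ratio_prod 0 (real (Max (insert 0 F)))) \<le> norm (\<Prod>p\<in>F. euler_ratio 0 p)"
      unfolding ratio_prod_def by (intro norm_prod_euler_ratio_antimono) auto
    thus "l \<le> (\<Prod>p\<in>F. norm (euler_ratio 0 p))"
      using norm_ge[of "real (Max (insert 0 F))"] by (simp add: prod_norm)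
  qed (simp add: norm_euler_ratio_le_1)
  thus "(\<lambda>p. (1 - norm (euler_ratio 0 p)) + 2 * first_order_error p) summable_on {p. prime p}"
    by (intro summable_on_add summable_on_cmult_right summable_on_first_order_error)
qed (simp_all add: Re_gap_le Re_gap_nonneg)

definition damping :: "real \<Rightarrow> real \<Rightarrow> nat \<Rightarrow> real" where
  "damping c x p = (if real p \<le> x then c / ln x * ln (real p) else real p powr (- (c / ln x)))"

definition truncated_ratio :: "real \<Rightarrow> nat \<Rightarrow> complex" where
  "truncated_ratio x p = (if real p \<le> x then euler_ratio 0 p else 1)"

lemma damping_bounds:
  assumes "p \<ge> 1" "c > 0" "x \<ge> exp 1"
  shows "0 \<le> damping c x p" "damping c x p \<le> c + 1"
    "damping c x p \<le> (c * exp c + 1) / ln x * (ln (real p) * real p powr (- (c / ln x)))"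
proof -
  define L t where "L = ln x" and "t = real p powr (- (c / L))"
  have x_pos: "x > 0" by (rule less_le_trans[OF exp_gt_zero assms(3)])
  have L_ge_1: "L \<ge> 1" using ln_ge_1[OF assms(3)] by (simp add: L_def)
  have t_bounds: "0 \<le> t" "t \<le> 1"
    using assms L_ge_1 by (auto simp: t_def intro!: powr_uminus_le_1)
  have ln_nonneg: "ln (real p) \<ge> 0" using assms by simp
  have "0 \<le> damping c x p \<and> damping c x p \<le> c + 1 \<and>
      damping c x p \<le> (c * exp c + 1) / L * (ln (real p) * t)"
  proof (cases "real p \<le> x")
    case True
    have le_c: "c / L * ln (real p) \<le> c"
      using True assms L_ge_1 mult_left_mono[of "ln (real p)" L c]
      by (simp add: L_def divide_le_eq)
    hence "exp (- c) \<le> t" using assms by (simp add: t_def powr_def)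
    hence "1 \<le> exp c * t"
      using mult_left_mono[of "exp (- c)" t "exp c"] by (simp add: exp_add[symmetric])
    hence "c / L * ln (real p) * 1 \<le> c / L * ln (real p) * (exp c * t)"
      using assms L_ge_1 ln_nonneg by (intro mult_left_mono) auto
    also have "\<dots> \<le> (c * exp c + 1) / L * (ln (real p) * t)"
      using L_ge_1 ln_nonneg t_bounds by (simp add: field_simps)
    finally show ?thesis
      using True le_c assms L_ge_1 ln_nonneg by (simp add: damping_def L_def)
  next
    case False
    hence "L \<le> ln (real p)" using x_pos by (simp add: L_def)
    hence "t * L \<le> t * ln (real p)" using t_bounds(1) by (rule mult_left_mono)
    also have "\<dots> \<le> (c * exp c + 1) * (ln (real p) * t)"
      using ln_nonneg t_bounds assms by (simp add: algebra_simps)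
    finally have "t \<le> (c * exp c + 1) / L * (ln (real p) * t)"
      using L_ge_1 by (simp add: field_simps)
    thus ?thesis using False assms t_bounds by (simp add: damping_def L_def t_def)
  qed
  thus "0 \<le> damping c x p" "damping c x p \<le> c + 1"
    "damping c x p \<le> (c * exp c + 1) / ln x * (ln (real p) * real p powr (- (c / ln x)))"
    by (auto simp: L_def t_def)
qed

lemma norm_euler_ratio_diff_truncated_le:
  assumes "prime p" "c > 0" "x \<ge> exp 1"
  shows "norm (euler_ratio (c / ln x) p - truncated_ratio x p) \<le>
    norm (gap p) * damping c x p + 2 * first_order_error p"
proof -
  define t where "t = real p powr (- (c / ln x))"
  define r where "r = euler_ratio (c / ln x) p - (1 - gap p * of_real t)"
  define r0 where "r0 = euler_ratio 0 p - (1 - gap p)"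
  have exponent: "c / ln x \<ge> 0" using assms(2) ln_ge_1[OF assms(3)] by simp
  have errors: "norm r \<le> first_order_error p" "norm r0 \<le> first_order_error p"
    using euler_ratio_first_order[OF assms(1) exponent] euler_ratio_0_first_order[OF assms(1)]
    by (auto simp: r_def r0_def t_def)
  show ?thesis
  proof (cases "real p \<le> x")
    case True
    have "t \<le> 1"
      using prime_ge_1_nat[OF assms(1)] exponent by (auto simp: t_def intro!: powr_uminus_le_1)
    moreover have "1 - t \<le> damping c x p"
      using True exp_ge_add_one_self[of "- (c / ln x * ln (real p))"] prime_gt_0_nat[OF assms(1)]
      by (simp add: t_def damping_def powr_def)
    ultimately have "norm (gap p * of_real (1 - t)) \<le> norm (gap p) * damping c x p"
      unfolding norm_mult norm_of_real by (intro mult_left_mono) auto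
    moreover have "euler_ratio (c / ln x) p - truncated_ratio x p =
        (r - r0) + gap p * of_real (1 - t)"
      using True by (simp add: truncated_ratio_def r_def r0_def algebra_simps)
    ultimately show ?thesis
      using errors norm_triangle_ineq[of "r - r0" "gap p * of_real (1 - t)"]
        norm_triangle_ineq4[of r r0]
      by simp
  next
    case False
    have "euler_ratio (c / ln x) p - truncated_ratio x p = r - gap p * of_real t"
      using False by (simp add: truncated_ratio_def r_def)
    thus ?thesis
      using False errors norm_triangle_ineq4[of r "gap p * of_real t"]
        first_order_error_nonneg[OF assms(1)]
      by (simp add: damping_def t_def norm_mult)
  qed
qed

lemma norm_euler_ratio_diff_truncated_le_primepow_log:
  assumes "prime p" "c > 0" "x \<ge> exp 1" "\<eta> > 0"
  shows "norm (euler_ratio (c / ln x) p - truncated_ratio x p) \<le>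
    \<eta> * (c * exp c + 1) / ln x * dirichlet_term (primepow_log g) (c / ln x) p +
    ((c + 1) / (2 * \<eta>) * Re (gap p) + 2 * first_order_error p)"
proof -
  note damping = damping_bounds[OF prime_ge_1_nat[OF assms(1)] assms(2,3)]
  have "norm (gap p) * damping c x p \<le>
      (\<eta> * (g p / real p) + Re (gap p) / (2 * \<eta>)) * damping c x p"
    using norm_gap_le_Re_gap[OF assms(1,4)] damping(1) by (rule mult_right_mono)
  also have "\<dots> = \<eta> * (g p / real p) * damping c x p + Re (gap p) / (2 * \<eta>) * damping c x p"
    by (rule distrib_right)
  also have "\<dots> \<le> \<eta> * (g p / real p) *
        ((c * exp c + 1) / ln x * (ln (real p) * real p powr (- (c / ln x)))) +
      Re (gap p) / (2 * \<eta>) * (c + 1)"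
    using damping g_nonneg[of p] Re_gap_nonneg[OF assms(1)] assms(4)
    by (intro add_mono mult_left_mono) auto
  also have "\<dots> = \<eta> * (c * exp c + 1) / ln x * dirichlet_term (primepow_log g) (c / ln x) p +
      (c + 1) / (2 * \<eta>) * Re (gap p)"
    using assms(1) by (simp add: dirichlet_term_def primepow_log_def mult_ac)
  finally show ?thesis using norm_euler_ratio_diff_truncated_le[OF assms(1-3)] by linarith
qed

lemma sum_euler_ratio_diff_truncated_le:
  assumes "finite S" "S \<subseteq> {p. prime p}" "c > 0" "x \<ge> exp 1" "\<eta> > 0"
  shows "(\<Sum>p\<in>S. norm (euler_ratio (c / ln x) p - truncated_ratio x p)) \<le>
    \<eta> * ((c * exp c + 1) * (C * (2 + 4 / c))) +
    (\<Sum>p\<in>S. (c + 1) / (2 * \<eta>) * Re (gap p) + 2 * first_order_error p)"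
proof -
  let ?w = "dirichlet_term (primepow_log g) (c / ln x)"
  let ?b = "\<lambda>p. (c + 1) / (2 * \<eta>) * Re (gap p) + 2 * first_order_error p"
  have ln_x_ge_1: "ln x \<ge> 1" by (rule ln_ge_1[OF assms(4)])
  have "(\<Sum>p\<in>S. norm (euler_ratio (c / ln x) p - truncated_ratio x p)) \<le>
      (\<Sum>p\<in>S. \<eta> * (c * exp c + 1) / ln x * ?w p + ?b p)"
    using assms by (intro sum_mono norm_euler_ratio_diff_truncated_le_primepow_log) auto
  also have "\<dots> = \<eta> * (c * exp c + 1) / ln x * sum ?w S + sum ?b S"
    by (simp add: sum.distrib sum_distrib_left)
  also have "\<eta> * (c * exp c + 1) / ln x * sum ?w S \<le>
      \<eta> * (c * exp c + 1) / ln x * (C * (2 + 4 / (c / ln x)))"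
    using assms ln_x_ge_1 by (intro mult_left_mono sum_dirichlet_term_primepow_log_le) auto
  also have "\<dots> = \<eta> * (c * exp c + 1) * (C * (2 / ln x + 4 / c))"
    using ln_x_ge_1 by (simp add: field_simps)
  also have "\<dots> \<le> \<eta> * (c * exp c + 1) * (C * (2 + 4 / c))"
    using assms ln_x_ge_1 C_nonneg
    by (intro mult_left_mono add_right_mono) (auto simp: divide_le_eq)
  finally show ?thesis by (simp add: mult.assoc)
qed

lemma sum_euler_ratio_diff_tail_less:
  assumes gap_summable: "(\<lambda>p. Re (gap p)) summable_on {p. prime p}" and "c > 0" "e > 0"
  shows "\<exists>y. \<forall>x\<ge>exp 1. \<forall>S. finite S \<longrightarrow> S \<subseteq> {p. prime p \<and> real p > y} \<longrightarrow>
    (\<Sum>p\<in>S. norm (euler_ratio (c / ln x) p - truncated_ratio x p)) < e"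
proof -
  define M where "M = (c * exp c + 1) * (C * (2 + 4 / c))"
  define \<eta> where "\<eta> = e / (2 * (M + 1))"
  define tail where "tail p = (c + 1) / (2 * \<eta>) * Re (gap p) + 2 * first_order_error p" for p
  have "M \<ge> 0" using \<open>c > 0\<close> C_nonneg by (simp add: M_def)
  hence \<eta>_bounds: "\<eta> > 0" "\<eta> * M \<le> e / 2"
    using \<open>e > 0\<close> by (auto simp: \<eta>_def field_simps)
  have "tail summable_on {p. prime p}"
    unfolding tail_def[abs_def]
    by (intro summable_on_add summable_on_cmult_right gap_summable summable_on_first_order_error)
  moreover have "tail p \<ge> 0" if "prime p" for p
    using that Re_gap_nonneg first_order_error_nonneg \<eta>_bounds \<open>c > 0\<close> by (simp add: tail_def)
  ultimately obtain y where tail_small: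
    "\<And>S. finite S \<Longrightarrow> S \<subseteq> {p. prime p \<and> real p > y} \<Longrightarrow> sum tail S < e / 2"
    using sum_tail_less_if_summable_on[of tail "{p. prime p}" "e / 2"] \<open>e > 0\<close> by auto
  have "(\<Sum>p\<in>S. norm (euler_ratio (c / ln x) p - truncated_ratio x p)) < e"
    if "x \<ge> exp 1" "finite S" "S \<subseteq> {p. prime p \<and> real p > y}" for x S
  proof -
    have "(\<Sum>p\<in>S. norm (euler_ratio (c / ln x) p - truncated_ratio x p)) \<le> \<eta> * M + sum tail S"
      unfolding M_def tail_def using that \<open>c > 0\<close> \<eta>_bounds(1)
      by (intro sum_euler_ratio_diff_truncated_le) auto
    thus ?thesis using \<eta>_bounds(2) tail_small[OF that(2,3)] by linarith
  qed
  thus ?thesis by blast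
qed

lemma norm_ratio_prod_diff_le:
  assumes "x \<le> z" "\<sigma> \<ge> 0"
  shows "norm (ratio_prod \<sigma> z - ratio_prod 0 x) \<le>
    (\<Sum>p\<in>primes_upto z. norm (euler_ratio \<sigma> p - truncated_ratio x p))"
proof -
  have "ratio_prod 0 x = (\<Prod>p\<in>primes_upto z. truncated_ratio x p)"
    unfolding ratio_prod_def
    by (rule prod.mono_neutral_cong_left)
      (use assms in \<open>auto simp: truncated_ratio_def primes_upto_def\<close>)
  thus ?thesis
    unfolding ratio_prod_def using assms(2)
    by (auto intro!: norm_prod_diff norm_euler_ratio_le_1 simp: truncated_ratio_def)
qed

lemma eventually_sum_euler_ratio_diff_less:
  assumes "c > 0" "e > 0"
  shows "\<forall>\<^sub>F x in at_top. (\<Sum>p\<in>primes_upto y. norm (euler_ratio (c / ln x) p - euler_ratio 0 p)) < e"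
proof -
  have "((\<lambda>\<sigma>. \<Sum>p\<in>primes_upto y. norm (euler_ratio \<sigma> p - euler_ratio 0 p)) \<longlongrightarrow>
      (\<Sum>p\<in>primes_upto y. norm (euler_ratio 0 p - euler_ratio 0 p))) (at_right 0)"
    by (intro tendsto_intros euler_ratio_tendsto) auto
  hence "\<forall>\<^sub>F \<sigma> in at_right 0. (\<Sum>p\<in>primes_upto y. norm (euler_ratio \<sigma> p - euler_ratio 0 p)) < e"
    by (rule order_tendstoD) (use \<open>e > 0\<close> in simp)
  thus ?thesis
    using filterlim_divide_ln_at_right_0[OF \<open>c > 0\<close>] by (rule eventually_compose_filterlim)
qed

lemma dirichlet_ratio_minus_ratio_prod_tendsto_0_if_summable:
  assumes "c > 0" and gap_summable: "(\<lambda>p. Re (gap p)) summable_on {p. prime p}"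
  shows "((\<lambda>x. dirichlet_ratio (c / ln x) - ratio_prod 0 x) \<longlongrightarrow> 0) at_top"
proof (rule tendstoI)
  fix e :: real assume "e > 0"
  obtain y where tail_small: "\<And>x S. x \<ge> exp 1 \<Longrightarrow> finite S \<Longrightarrow> S \<subseteq> {p. prime p \<and> real p > y} \<Longrightarrow>
      (\<Sum>p\<in>S. norm (euler_ratio (c / ln x) p - truncated_ratio x p)) < e / 4"
    using sum_euler_ratio_diff_tail_less[OF gap_summable \<open>c > 0\<close>, of "e / 4"] \<open>e > 0\<close> by auto
  have "\<forall>\<^sub>F x in at_top.
      (\<Sum>p\<in>primes_upto y. norm (euler_ratio (c / ln x) p - euler_ratio 0 p)) < e / 4"
    using \<open>c > 0\<close> \<open>e > 0\<close> by (intro eventually_sum_euler_ratio_diff_less) auto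
  thus "\<forall>\<^sub>F x in at_top. dist (dirichlet_ratio (c / ln x) - ratio_prod 0 x) 0 < e"
    using eventually_ge_at_top[of y] eventually_ge_at_top[of "exp 1"]
  proof eventually_elim
    case (elim x)
    let ?d = "\<lambda>p. norm (euler_ratio (c / ln x) p - truncated_ratio x p)"
    have exponent: "c / ln x > 0" using \<open>c > 0\<close> ln_ge_1[OF elim(3)] by simp
    have "norm (ratio_prod (c / ln x) z - ratio_prod 0 x) \<le> e / 2" if "z \<ge> x" for z
    proof -
      have "norm (ratio_prod (c / ln x) z - ratio_prod 0 x) \<le> sum ?d (primes_upto z)"
        using that exponent by (intro norm_ratio_prod_diff_le) auto
      also have "\<dots> = sum ?d (primes_upto z - primes_upto y) + sum ?d (primes_upto y)"
        using that elim(2) by (intro sum.subset_diff primes_upto_mono) auto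
      also have "sum ?d (primes_upto y) =
          (\<Sum>p\<in>primes_upto y. norm (euler_ratio (c / ln x) p - euler_ratio 0 p))"
        using elim(2) by (intro sum.cong) (auto simp: truncated_ratio_def primes_upto_def)
      also have "sum ?d (primes_upto z - primes_upto y) < e / 4"
        by (rule tail_small[OF elim(3)]) (auto simp: primes_upto_def)
      finally show ?thesis using elim(1) by simp
    qed
    hence "\<forall>\<^sub>F z in at_top. norm (ratio_prod (c / ln x) z - ratio_prod 0 x) \<le> e / 2"
      using eventually_ge_at_top by (rule eventually_mono[rotated])
    moreover have "((\<lambda>z. ratio_prod (c / ln x) z - ratio_prod 0 x) \<longlongrightarrow>
        dirichlet_ratio (c / ln x) - ratio_prod 0 x) at_top"
      by (intro tendsto_diff ratio_prod_tendsto_dirichlet_ratio exponent tendsto_const)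
    ultimately have "norm (dirichlet_ratio (c / ln x) - ratio_prod 0 x) \<le> e / 2"
      by (intro Lim_norm_ubound) auto
    thus ?case using \<open>e > 0\<close> by simp
  qed
qed

lemma dirichlet_ratio_minus_ratio_prod_tendsto_0:
  assumes "c > 0"
  shows "((\<lambda>x. dirichlet_ratio (c / ln x) - ratio_prod 0 x) \<longlongrightarrow> 0) at_top"
proof (cases "\<exists>l>0. \<forall>x. norm (ratio_prod 0 x) \<ge> l")
  case True
  thus ?thesis
    using summable_on_Re_gap dirichlet_ratio_minus_ratio_prod_tendsto_0_if_summable[OF assms]
    by blast
next
  case False
  thus ?thesis
    by (intro dirichlet_ratio_minus_ratio_prod_tendsto_0_if_vanishing assms) (meson not_le)
qed

end

subsection \<open>The Tauberian argument\<close>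

definition approximates_jump :: "real poly \<Rightarrow> real \<Rightarrow> real \<Rightarrow> real \<Rightarrow> bool" where
  "approximates_jump q c b \<epsilon> \<longleftrightarrow>
    (\<forall>u\<in>{0..1}. \<bar>of_bool (b \<le> u) - u * poly q u\<bar> \<le> \<epsilon> * u + of_bool (c < u \<and> u < b))"

lemma poly_Stone_Weierstrass:
  fixes f :: "real \<Rightarrow> real"
  assumes "compact S" "continuous_on S f" "\<epsilon> > 0"
  obtains q :: "real poly" where "\<And>u. u \<in> S \<Longrightarrow> \<bar>f u - poly q u\<bar> < \<epsilon>"
proof -
  obtain Q where Q_approx: "real_polynomial_function Q" "\<And>u. u \<in> S \<Longrightarrow> \<bar>f u - Q u\<bar> < \<epsilon>"
    using Stone_Weierstrass_real_polynomial_function[OF assms] by auto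
  obtain a m where Q_eq: "Q = (\<lambda>x. \<Sum>i\<le>m. a i * x ^ i)"
    using Q_approx(1) unfolding real_polynomial_function_iff_sum by auto
  have "poly (\<Sum>i\<le>m. monom (a i) i) u = Q u" for u
    by (simp add: Q_eq poly_sum poly_monom)
  thus ?thesis using that[of "\<Sum>i\<le>m. monom (a i) i"] Q_approx(2) by simp
qed

lemma ex_approximates_jump:
  assumes "0 < c" "c < b" "\<epsilon> > 0"
  shows "\<exists>q. approximates_jump q c b \<epsilon>"
proof -
  define ramp where "ramp u = min 1 (max 0 ((u - c) / (b - c)))" for u
  define \<psi> where "\<psi> u = ramp u / max u b" for u
  have "continuous_on {0..1} \<psi>"
    unfolding \<psi>_def ramp_def using assms by (intro continuous_intros) auto
  then obtain q where q_close: "\<And>u. u \<in> {0..1} \<Longrightarrow> \<bar>\<psi> u - poly q u\<bar> < \<epsilon>"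
    using poly_Stone_Weierstrass[of "{0..1}" \<psi> \<epsilon>] assms by auto
  have "\<bar>of_bool (b \<le> u) - u * poly q u\<bar> \<le> \<epsilon> * u + of_bool (c < u \<and> u < b)"
    if "u \<in> {0..1}" for u
  proof -
    have "u * \<bar>\<psi> u - poly q u\<bar> \<le> u * \<epsilon>"
      using that q_close[OF that] by (intro mult_left_mono) auto
    hence "\<bar>u * \<psi> u - u * poly q u\<bar> \<le> \<epsilon> * u"
      using that by (simp add: abs_mult flip: right_diff_distrib) (simp add: mult.commute)
    moreover have "b \<le> u \<Longrightarrow> ramp u = 1" "u \<le> c \<Longrightarrow> ramp u = 0" "0 \<le> ramp u" "ramp u \<le> 1"
      using assms by (auto simp: ramp_def divide_nonpos_pos)
    hence "\<bar>of_bool (b \<le> u) - u * \<psi> u\<bar> \<le> of_bool (c < u \<and> u < b)"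
      using that assms mult_mono[of u b "ramp u" 1] by (auto simp: \<psi>_def max_def divide_le_eq)
    ultimately show ?thesis by linarith
  qed
  thus ?thesis unfolding approximates_jump_def by blast
qed

lemma exp_le_powr_divide_ln_iff:
  fixes x y A :: real
  assumes "x > 1" "A > 0" "y > 0"
  shows "exp (- (A * t)) \<le> y powr (- (A / ln x)) \<longleftrightarrow> y \<le> x powr t"
proof -
  have "exp (- (A * t)) \<le> y powr (- (A / ln x)) \<longleftrightarrow> A * ln y \<le> A * (t * ln x)"
    using assms by (simp add: powr_def field_simps)
  also have "\<dots> \<longleftrightarrow> ln y \<le> ln (x powr t)" using assms by (simp add: ln_powr)
  also have "\<dots> \<longleftrightarrow> y \<le> x powr t" using assms by (intro ln_le_cancel_iff) auto
  finally show ?thesis .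
qed

lemma dirichlet_term_0_mult_poly:
  fixes f :: "nat \<Rightarrow> 'a :: real_normed_field"
  shows "dirichlet_term f 0 n * of_real (real n powr (- \<sigma>) * poly q (real n powr (- \<sigma>))) =
    (\<Sum>i\<le>degree q. of_real (coeff q i) * dirichlet_term f (real (Suc i) * \<sigma>) n)"
proof -
  have "(real n powr (- \<sigma>)) ^ Suc i = real n powr (- (real (Suc i) * \<sigma>))" for i
    by (cases "n = 0") (simp_all add: powr_power del: power_Suc of_nat_Suc)
  hence "real n powr (- \<sigma>) * poly q (real n powr (- \<sigma>)) =
      (\<Sum>i\<le>degree q. coeff q i * real n powr (- (real (Suc i) * \<sigma>)))"
    by (simp add: poly_altdef sum_distrib_left mult.left_commute)
  thus ?thesis
    by (simp add: sum_distrib_left dirichlet_term_def mult_ac)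
qed

definition poly_dirichlet_sum :: "(nat \<Rightarrow> 'a :: real_normed_field) \<Rightarrow> real poly \<Rightarrow> real \<Rightarrow> 'a" where
  "poly_dirichlet_sum f q \<sigma> =
    (\<Sum>i\<le>degree q. of_real (coeff q i) * dirichlet_series f (real (Suc i) * \<sigma>))"

lemma log_sum_sums:
  "(\<lambda>n. dirichlet_term f 0 n * of_real (of_bool (n \<ge> 1 \<and> real n \<le> x))) sums log_sum f x"
proof -
  have "(\<lambda>n. if n \<in> {n. 1 \<le> n \<and> real n \<le> x} then f n / of_nat n else 0) sums log_sum f x"
    unfolding log_sum_def by (rule sums_If_finite_set) simp
  also have "(\<lambda>n. if n \<in> {n. 1 \<le> n \<and> real n \<le> x} then f n / of_nat n else 0) =
      (\<lambda>n. dirichlet_term f 0 n * of_real (of_bool (n \<ge> 1 \<and> real n \<le> x)))"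
    by (auto simp: dirichlet_term_zero_exponent)
  finally show ?thesis .
qed

context chebyshev_multiplicative
begin

lemma poly_dirichlet_sum_sums:
  fixes f :: "nat \<Rightarrow> 'a :: {real_normed_field, banach}"
  assumes "mult_dominated f g" "\<sigma> > 0"
  shows "(\<lambda>n. dirichlet_term f 0 n * of_real (real n powr (- \<sigma>) * poly q (real n powr (- \<sigma>))))
    sums poly_dirichlet_sum f q \<sigma>"
  unfolding dirichlet_term_0_mult_poly poly_dirichlet_sum_def dirichlet_series_def
  by (intro sums_sum sums_mult summable_sums
      summable_norm_cancel[OF summable_norm_dirichlet_term[OF assms(1)]])
    (use assms in simp)

lemma norm_log_sum_term_diff_le:
  fixes f :: "nat \<Rightarrow> 'a :: {real_normed_field, banach}"
  assumes "mult_dominated f g" "x > 1" "A > 0"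
    and jump: "approximates_jump q (exp (- (A * (1 + \<delta>)))) (exp (- A)) \<epsilon>"
  defines "u \<equiv> \<lambda>n. real n powr (- (A / ln x))"
  shows "norm (dirichlet_term f 0 n * of_real (of_bool (n \<ge> 1 \<and> real n \<le> x)) -
      dirichlet_term f 0 n * of_real (u n * poly q (u n))) \<le>
    \<epsilon> * dirichlet_term g (A / ln x) n +
      (if n \<in> {n. x < real n \<and> real n \<le> x powr (1 + \<delta>)} then g n / real n else 0)"
    (is "norm ?d \<le> _ + (if n \<in> ?W then _ else _)")
proof (cases "n = 0")
  case False
  hence "n \<ge> 1" by simp
  have u_unit: "u n \<in> {0..1}"
    using \<open>n \<ge> 1\<close> assms by (auto simp: u_def intro!: powr_uminus_le_1)
  have "exp (- (A * t)) \<le> u n \<longleftrightarrow> real n \<le> x powr t" for t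
    using exp_le_powr_divide_ln_iff[OF assms(2,3), of "real n" t] \<open>n \<ge> 1\<close> by (simp add: u_def)
  from this[of 1] this[of "1 + \<delta>"]
  have jump_at_x: "exp (- A) \<le> u n \<longleftrightarrow> real n \<le> x"
    and window: "exp (- (A * (1 + \<delta>))) < u n \<and> u n < exp (- A) \<Longrightarrow> n \<in> ?W"
    using assms(2) by auto
  have "of_bool (exp (- (A * (1 + \<delta>))) < u n \<and> u n < exp (- A)) \<le> (of_bool (n \<in> ?W) :: real)"
    using window by (cases "n \<in> ?W") (auto simp del: mem_Collect_eq)
  moreover have "\<bar>of_bool (exp (- A) \<le> u n) - u n * poly q (u n)\<bar> \<le>
      \<epsilon> * u n + of_bool (exp (- (A * (1 + \<delta>))) < u n \<and> u n < exp (- A))"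
    using jump u_unit unfolding approximates_jump_def by blast
  ultimately have "\<bar>of_bool (real n \<le> x) - u n * poly q (u n)\<bar> \<le> \<epsilon> * u n + of_bool (n \<in> ?W)"
    unfolding jump_at_x by linarith
  hence "norm (dirichlet_term f 0 n) * \<bar>of_bool (real n \<le> x) - u n * poly q (u n)\<bar> \<le>
      dirichlet_term g 0 n * (\<epsilon> * u n + of_bool (n \<in> ?W))"
    by (intro mult_mono norm_dirichlet_term_dominated_le assms(1) dirichlet_term_g_nonneg) auto
  moreover have "?d = dirichlet_term f 0 n * of_real (of_bool (real n \<le> x) - u n * poly q (u n))"
    using \<open>n \<ge> 1\<close> by (simp add: algebra_simps)
  ultimately have "norm ?d \<le> dirichlet_term g 0 n * (\<epsilon> * u n + of_bool (n \<in> ?W))"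
    by (simp only: norm_mult norm_of_real)
  also have "\<dots> = \<epsilon> * dirichlet_term g (A / ln x) n + (if n \<in> ?W then g n / real n else 0)"
    using \<open>n \<ge> 1\<close> by (simp add: dirichlet_term_def u_def distrib_left)
  finally show ?thesis .
qed (use assms(2) in simp)

lemma norm_log_sum_diff_poly_dirichlet_sum_le:
  fixes f :: "nat \<Rightarrow> 'a :: {real_normed_field, banach}"
  assumes "mult_dominated f g" "x > 1" "A > 0"
    and jump: "approximates_jump q (exp (- (A * (1 + \<delta>)))) (exp (- A)) \<epsilon>"
  shows "norm (log_sum f x - poly_dirichlet_sum f q (A / ln x)) \<le>
    \<epsilon> * dirichlet_series g (A / ln x) +
    (\<Sum>n | x < real n \<and> real n \<le> x powr (1 + \<delta>). g n / real n)"
proof -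
  define \<sigma> where "\<sigma> = A / ln x"
  let ?u = "\<lambda>n. real n powr (- \<sigma>)"
  let ?W = "{n. x < real n \<and> real n \<le> x powr (1 + \<delta>)}"
  let ?d = "\<lambda>n. dirichlet_term f 0 n * of_real (of_bool (n \<ge> 1 \<and> real n \<le> x)) -
    dirichlet_term f 0 n * of_real (?u n * poly q (?u n))"
  let ?M = "\<lambda>n. \<epsilon> * dirichlet_term g \<sigma> n + (if n \<in> ?W then g n / real n else 0)"
  have \<sigma>_pos: "\<sigma> > 0" using assms by (simp add: \<sigma>_def)
  have diff_le: "norm (?d n) \<le> ?M n" for n
    unfolding \<sigma>_def by (rule norm_log_sum_term_diff_le[OF assms])
  have majorant_sums: "?M sums (\<epsilon> * dirichlet_series g \<sigma> + (\<Sum>n\<in>?W. g n / real n))"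
    unfolding dirichlet_series_def
    by (intro sums_add sums_mult summable_sums summable_dirichlet_term_g \<sigma>_pos
        sums_If_finite_set) simp
  have diff_sums: "?d sums (log_sum f x - poly_dirichlet_sum f q \<sigma>)"
    by (intro sums_diff log_sum_sums poly_dirichlet_sum_sums assms(1) \<sigma>_pos)
  have abs_summable: "summable (\<lambda>n. norm (?d n))"
    by (rule summable_comparison_test'[OF sums_summable[OF majorant_sums], where N = 0])
      (use diff_le in simp)
  have "norm (log_sum f x - poly_dirichlet_sum f q \<sigma>) \<le> (\<Sum>n. norm (?d n))"
    using summable_norm[OF abs_summable] sums_unique[OF diff_sums] by simp
  also have "\<dots> \<le> \<epsilon> * dirichlet_series g \<sigma> + (\<Sum>n\<in>?W. g n / real n)"
    by (rule sums_le[OF diff_le summable_sums[OF abs_summable] majorant_sums])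
  finally show ?thesis by (simp add: \<sigma>_def)
qed

lemma log_sum_g_short_interval_le:
  assumes "x \<ge> exp 1" "A > 0" "0 < \<delta>" "\<delta> \<le> 1"
  shows "(\<Sum>n | x < real n \<and> real n \<le> x powr (1 + \<delta>). g n / real n) \<le>
    2 * C * exp (2 * A) * (2 * \<delta> + 1 / ln x) * dirichlet_series g (A / ln x)"
proof -
  define L where "L = ln x"
  define z where "z = x powr (1 + \<delta>)"
  have x_gt_1: "x > 1" using less_le_trans[OF _ assms(1), of 1] by simp
  have L_ge_1: "L \<ge> 1" using ln_ge_1[OF assms(1)] by (simp add: L_def)
  have "z / x = x powr \<delta>" using x_gt_1 by (simp add: z_def powr_add)
  hence ln_ratio: "ln (z / x) = \<delta> * L" using x_gt_1 by (simp add: L_def ln_powr)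
  have "x \<le> z" using powr_mono[of 1 "1 + \<delta>" x] x_gt_1 \<open>\<delta> > 0\<close> by (simp add: z_def)
  have "dirichlet_series g (A / L) \<ge> 1" using L_ge_1 \<open>A > 0\<close> by (intro dirichlet_series_g_ge_1) auto
  hence series_nonneg: "dirichlet_series g (A / L) \<ge> 0" by linarith
  have "(\<Sum>n | x < real n \<and> real n \<le> z. g n / real n) \<le>
      2 * C * (2 * (\<delta> * L) + 1) / L * log_sum g z"
    using log_sum_g_diff_le[OF x_gt_1 \<open>x \<le> z\<close>] by (simp add: ln_ratio L_def)
  also have "\<dots> \<le> 2 * C * (2 * (\<delta> * L) + 1) / L * (exp (2 * A) * dirichlet_series g (A / L))"
  proof (rule mult_left_mono)
    have "log_sum g z \<le> z powr (A / L) * dirichlet_series g (A / L)"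
      using x_gt_1 \<open>x \<le> z\<close> L_ge_1 \<open>A > 0\<close> by (intro log_sum_g_le_dirichlet_series) auto
    also have "z powr (A / L) = exp ((1 + \<delta>) * A)"
      using x_gt_1 L_ge_1 by (simp add: z_def powr_powr powr_def L_def)
    also have "\<dots> * dirichlet_series g (A / L) \<le> exp (2 * A) * dirichlet_series g (A / L)"
      using series_nonneg assms by (intro mult_right_mono) auto
    finally show "log_sum g z \<le> exp (2 * A) * dirichlet_series g (A / L)" .
  qed (use C_nonneg L_ge_1 assms in simp)
  also have "2 * C * (2 * (\<delta> * L) + 1) / L = 2 * C * (2 * \<delta> + 1 / L)"
    using L_ge_1 by (simp add: field_simps)
  finally show ?thesis by (simp only: L_def z_def mult_ac)
qed

end

context dominated_multiplicative
begin

lemma norm_poly_dirichlet_sum_diff_le: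
  assumes "\<sigma> > 0"
  shows "norm (poly_dirichlet_sum h q \<sigma> - P * of_real (poly_dirichlet_sum g q \<sigma>)) \<le>
    (\<Sum>i\<le>degree q. \<bar>coeff q i\<bar> * norm (dirichlet_ratio (real (Suc i) * \<sigma>) - P)) *
    dirichlet_series g \<sigma>"
proof -
  define s where "s i = real (Suc i) * \<sigma>" for i
  define R where "R i = dirichlet_ratio (s i) - P" for i
  have s_bounds: "s i > 0" "\<sigma> \<le> s i" for i
    using assms mult_right_mono[of 1 "real (Suc i)" \<sigma>] by (auto simp: s_def simp del: of_nat_Suc)
  have series_ge_1: "dirichlet_series g (s i) \<ge> 1" for i by (intro dirichlet_series_g_ge_1 s_bounds)
  have "dirichlet_series h (s i) = dirichlet_ratio (s i) * of_real (dirichlet_series g (s i))" for i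
    using series_ge_1[of i] by (auto simp: dirichlet_ratio_def)
  hence "poly_dirichlet_sum h q \<sigma> - P * of_real (poly_dirichlet_sum g q \<sigma>) =
      (\<Sum>i\<le>degree q. of_real (coeff q i) * (R i * of_real (dirichlet_series g (s i))))"
    unfolding poly_dirichlet_sum_def s_def[symmetric] R_def
    by (simp add: sum_distrib_left sum_subtractf algebra_simps)
  also have "norm \<dots> \<le> (\<Sum>i\<le>degree q. \<bar>coeff q i\<bar> * norm (R i) * dirichlet_series g \<sigma>)"
  proof (rule sum_norm_le)
    fix i
    have "norm (of_real (coeff q i) * (R i * of_real (dirichlet_series g (s i)))) =
        \<bar>coeff q i\<bar> * norm (R i) * dirichlet_series g (s i)"
      using series_ge_1[of i] by (simp add: norm_mult)
    also have "\<dots> \<le> \<bar>coeff q i\<bar> * norm (R i) * dirichlet_series g \<sigma>"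
      using s_bounds assms by (intro mult_left_mono dirichlet_series_g_antimono) auto
    finally show "norm (of_real (coeff q i) * (R i * of_real (dirichlet_series g (s i)))) \<le>
        \<bar>coeff q i\<bar> * norm (R i) * dirichlet_series g \<sigma>" .
  qed
  finally show ?thesis by (simp add: R_def s_def sum_distrib_right)
qed

lemma norm_log_sum_diff_le:
  assumes "x \<ge> exp 1" "A > 0" "0 < \<epsilon>" "\<epsilon> \<le> 1"
    and jump: "approximates_jump q (exp (- (A * (1 + \<epsilon>)))) (exp (- A)) \<epsilon>"
    and P_bound: "norm P \<le> 1"
  shows "norm (log_sum h x - P * of_real (log_sum g x)) \<le>
    (2 * (\<epsilon> + 2 * C * exp (2 * A) * (2 * \<epsilon> + 1 / ln x)) +
      (\<Sum>i\<le>degree q. \<bar>coeff q i\<bar> * norm (dirichlet_ratio (real (Suc i) * A / ln x) - P))) *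
    dirichlet_series g (A / ln x)"
proof -
  define \<sigma> where "\<sigma> = A / ln x"
  define B where
    "B = (\<epsilon> + 2 * C * exp (2 * A) * (2 * \<epsilon> + 1 / ln x)) * dirichlet_series g \<sigma>"
  define poly_h where "poly_h = poly_dirichlet_sum h q \<sigma>"
  define poly_g where "poly_g = poly_dirichlet_sum g q \<sigma>"
  have x_gt_1: "x > 1" using less_le_trans[OF _ assms(1), of 1] by simp
  hence \<sigma>_pos: "\<sigma> > 0" using assms(2) by (simp add: \<sigma>_def)
  have approx: "norm (log_sum f x - poly_dirichlet_sum f q \<sigma>) \<le> B" if "mult_dominated f g"
    for f :: "nat \<Rightarrow> 'a :: {real_normed_field, banach}"
    using norm_log_sum_diff_poly_dirichlet_sum_le[OF that x_gt_1 assms(2) jump]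
      log_sum_g_short_interval_le[OF assms(1-4)]
    by (simp add: B_def \<sigma>_def algebra_simps)
  have "norm (complex_of_real (log_sum g x - poly_g)) \<le> B"
    using approx[OF mult_dominated_g] unfolding norm_of_real poly_g_def by simp
  hence "norm (P * of_real (log_sum g x - poly_g)) \<le> B"
    using mult_mono[OF P_bound, of _ B] P_bound by (simp add: norm_mult del: of_real_diff)
  moreover have "norm (log_sum h x - poly_h) \<le> B"
    unfolding poly_h_def by (rule approx[OF mult_dominated_h])
  moreover note norm_poly_dirichlet_sum_diff_le[OF \<sigma>_pos, of q P, folded poly_h_def poly_g_def]
  moreover have "log_sum h x - P * of_real (log_sum g x) =
      (log_sum h x - poly_h) + (poly_h - P * of_real poly_g) - P * of_real (log_sum g x - poly_g)"
    by (simp add: algebra_simps)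
  ultimately have "norm (log_sum h x - P * of_real (log_sum g x)) \<le>
      B + (\<Sum>i\<le>degree q. \<bar>coeff q i\<bar> * norm (dirichlet_ratio (real (Suc i) * \<sigma>) - P)) *
        dirichlet_series g \<sigma> + B"
    by (smt (verit, best) norm_triangle_mono norm_triangle_ineq4)
  thus ?thesis by (simp add: B_def \<sigma>_def algebra_simps)
qed

lemma eventually_norm_log_sum_diff_le:
  assumes "A > 0" "e > 0"
  shows "\<forall>\<^sub>F x in at_top. norm (log_sum h x - ratio_prod 0 x * of_real (log_sum g x)) \<le>
    e * dirichlet_series g (A / ln x)"
proof -
  define K where "K = 2 * (1 + 4 * C * exp (2 * A))"
  define \<epsilon> where "\<epsilon> = min 1 (e / (2 * K))"
  have K_pos: "K > 0" using C_nonneg by (simp add: K_def add_pos_nonneg)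
  have \<epsilon>_bounds: "0 < \<epsilon>" "\<epsilon> \<le> 1" using assms K_pos by (auto simp: \<epsilon>_def)
  have "\<epsilon> * K \<le> e / (2 * K) * K" using K_pos by (intro mult_right_mono) (auto simp: \<epsilon>_def)
  also have "\<dots> < e" using assms K_pos by simp
  finally have \<epsilon>_mult_K: "\<epsilon> * K < e" .
  obtain q where jump: "approximates_jump q (exp (- (A * (1 + \<epsilon>)))) (exp (- A)) \<epsilon>"
    using ex_approximates_jump[of "exp (- (A * (1 + \<epsilon>)))" "exp (- A)" \<epsilon>] assms \<epsilon>_bounds by auto
  define err where "err x = 2 * (\<epsilon> + 2 * C * exp (2 * A) * (2 * \<epsilon> + 1 / ln x)) +
    (\<Sum>i\<le>degree q. \<bar>coeff q i\<bar> *
      norm (dirichlet_ratio (real (Suc i) * A / ln x) - ratio_prod 0 x))" for x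
  have "(err \<longlongrightarrow> 2 * (\<epsilon> + 2 * C * exp (2 * A) * (2 * \<epsilon> + 0)) +
      (\<Sum>i\<le>degree q. \<bar>coeff q i\<bar> * norm (0 :: complex))) at_top"
    unfolding err_def
    by (intro tendsto_intros dirichlet_ratio_minus_ratio_prod_tendsto_0
        tendsto_divide_0[OF tendsto_const] filterlim_at_top_imp_at_infinity ln_at_top)
      (use assms in simp)
  moreover have "2 * (\<epsilon> + 2 * C * exp (2 * A) * (2 * \<epsilon> + 0)) +
      (\<Sum>i\<le>degree q. \<bar>coeff q i\<bar> * norm (0 :: complex)) < e"
    using \<epsilon>_mult_K by (simp add: K_def algebra_simps)
  ultimately have "\<forall>\<^sub>F x in at_top. err x < e" by (rule order_tendstoD)
  thus ?thesis
    using eventually_ge_at_top[of "exp 1"]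
  proof eventually_elim
    case (elim x)
    have "norm (log_sum h x - ratio_prod 0 x * of_real (log_sum g x)) \<le>
        err x * dirichlet_series g (A / ln x)"
      unfolding err_def
      by (intro norm_log_sum_diff_le elim(2) assms(1) \<epsilon>_bounds jump norm_ratio_prod_le_1) auto
    moreover have "dirichlet_series g (A / ln x) \<ge> 1"
      using ln_ge_1[OF elim(2)] assms(1) by (intro dirichlet_series_g_ge_1) simp
    ultimately show ?case
      using elim(1) mult_right_mono[of "err x" e "dirichlet_series g (A / ln x)"] by linarith
  qed
qed

lemma log_sum_ratio_tendsto:
  "((\<lambda>x. log_sum h x / of_real (log_sum g x) - ratio_prod 0 x) \<longlongrightarrow> 0) at_top"
proof (rule tendstoI)
  fix e :: real assume e_pos: "e > 0"
  define A where "A = 16 * C + 1"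
  have A_ge_1: "A \<ge> 1" using C_nonneg by (simp add: A_def)
  hence "\<forall>\<^sub>F x in at_top. norm (log_sum h x - ratio_prod 0 x * of_real (log_sum g x)) \<le>
      e / 4 * dirichlet_series g (A / ln x)"
    using e_pos by (intro eventually_norm_log_sum_diff_le) auto
  thus "\<forall>\<^sub>F x in at_top. dist (log_sum h x / of_real (log_sum g x) - ratio_prod 0 x) 0 < e"
    using eventually_ge_at_top[of "exp A"]
  proof eventually_elim
    case (elim x)
    have x_large: "x > 0" "ln x \<ge> A"
      using less_le_trans[OF exp_gt_zero elim(2)] elim(2) by (simp_all add: ln_ge_iff)
    have log_sum_ge_1: "log_sum g x \<ge> 1"
      using one_le_exp_iff[of A] A_ge_1 elim(2) by (intro log_sum_g_ge_1) linarith
    have "dirichlet_series g (A / ln x) \<le> 2 * log_sum g x"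
      using x_large A_ge_1 by (intro dirichlet_series_g_le_log_sum) (auto simp: A_def)
    hence "e / 4 * dirichlet_series g (A / ln x) \<le> e / 4 * (2 * log_sum g x)"
      using e_pos by (intro mult_left_mono) auto
    also have "\<dots> < e * log_sum g x" using e_pos log_sum_ge_1 by simp
    finally have "norm (log_sum h x - ratio_prod 0 x * of_real (log_sum g x)) < e * log_sum g x"
      using elim(1) by linarith
    moreover have "log_sum h x / of_real (log_sum g x) - ratio_prod 0 x =
        (log_sum h x - ratio_prod 0 x * of_real (log_sum g x)) / of_real (log_sum g x)"
      using log_sum_ge_1 by (simp add: field_simps)
    ultimately show ?case using log_sum_ge_1 by (simp add: norm_divide divide_less_eq)
  qed
qed

end

theorem theorem1:
  fixes g :: "nat \<Rightarrow> real" and h :: "nat \<Rightarrow> complex"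
  assumes g_mult: "multiplicative g"
    and g_nonneg: "\<And>n. g n \<ge> 0"
    and g_prime_bdd: "\<exists>\<beta>. \<forall>p. prime p \<longrightarrow> g p \<le> \<beta>"
    and g_higher_pp: "(\<lambda>q. g q / real q) summable_on {q. \<exists>p k. prime p \<and> k \<ge> 2 \<and> q = p ^ k}"
    and g_chebyshev: "\<exists>C. \<forall>y::real. y \<ge> 2 \<longrightarrow>
            \<bar>(1 / y) * (\<Sum>q | primepow q \<and> real q \<le> y. g q * ln (real q))\<bar> \<le> C"
    and h_mult: "multiplicative h"
    and h_bdd: "\<And>n. n \<ge> 1 \<Longrightarrow> norm (h n) \<le> g n"
  shows "\<exists>e :: real \<Rightarrow> complex. (e \<longlongrightarrow> 0) at_top \<and>
           (\<forall>\<^sub>F x in at_top.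
              (\<Sum>n | 1 \<le> n \<and> real n \<le> x. h n / of_nat n) =
              ((\<Prod>p | prime p \<and> real p \<le> x.
                  (\<Sum>k. h (p ^ k) / of_nat (p ^ k)) *
                  inverse (complex_of_real (\<Sum>k. g (p ^ k) / real (p ^ k)))) + e x)
              * complex_of_real (\<Sum>n | 1 \<le> n \<and> real n \<le> x. g n / real n))"
proof -
  obtain \<beta> where prime_le: "\<And>p. prime p \<Longrightarrow> g p \<le> \<beta>" using g_prime_bdd by blast
  obtain C where chebyshev: "\<And>y::real. y \<ge> 2 \<Longrightarrow>
      \<bar>(1 / y) * (\<Sum>q | primepow q \<and> real q \<le> y. g q * ln (real q))\<bar> \<le> C"
    using g_chebyshev by blast
  interpret dominated_multiplicative g \<beta> C h
  proof
    show "(\<Sum>q | primepow q \<and> real q \<le> y. g q * ln (real q)) \<le> C * y" if "y \<ge> 2" for y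
      using chebyshev[OF that] that by (simp add: abs_le_iff divide_le_eq)
  qed (use assms prime_le in \<open>auto simp: mult_dominated_def\<close>)
  define e where "e x = log_sum h x / of_real (log_sum g x) - ratio_prod 0 x" for x
  have "(e \<longlongrightarrow> 0) at_top" unfolding e_def by (rule log_sum_ratio_tendsto)
  moreover have "\<forall>\<^sub>F x in at_top. log_sum h x = (ratio_prod 0 x + e x) * of_real (log_sum g x)"
    using eventually_ge_at_top[of 1]
    by eventually_elim (use log_sum_g_ge_1 in \<open>force simp: e_def\<close>)
  ultimately show ?thesis
    unfolding log_sum_def ratio_prod_def primes_upto_def euler_ratio_def euler_factor_def
      dirichlet_term_zero_exponent divide_inverse[of _ "complex_of_real _"] of_nat_id
    by blast
qed

end
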